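(* Let $m\ge5$. For (duals of) critical 1-faces $x$ and $y$ of $C_m$, the product $\overline\Phi(x)\smile\overline\Phi(y)$ (simplicial cup product in $C^*(C_m)$) is a linear combination $\sum\pm c$ of dualized 2-faces $c$ each of which has one of the following forms: (i) $\left[\begin{smallmatrix}a&a&c\\ b&d&d\end{smallmatrix}\right]$ for $a<c<m>d>b$ and $b\ne a\ne d\ne c$, with trivial $\underline\Phi$-image unless $b\ne c$, in which case $\underline\Phi\left(\left[\begin{smallmatrix}a&a&c\\ b&d&d\end{smallmatrix}\right]\right)=\left[\begin{smallmatrix}a&a&c\\ b&d&d\end{smallmatrix}\right]$. (ii) $\left[\begin{smallmatrix}a&c&c\\ b&b&d\end{smallmatrix}\right]$ for $a<c\le m-1>d>b$ and $a\ne b\ne c\ne d$, with trivial $\underline\Phi$-image unless $a\ne d$, in which case $\underline\Phi\left(\left[\begin{smallmatrix}a&c&c\\ b&b&d\end{smallmatrix}\right]\right)=-\left[\begin{smallmatrix}a&a&c\\ b&d&d\end{smallmatrix}\right]$. (iii) $\left[\begin{smallmatrix}a&a&c\\ b&m&m\end{smallmatrix}\right]$ for $a<c<m-1\ge b$ and $b\ne a\ne m\ne c$, with trivial $\underline\Phi$-image unless $b\ne c$, in which case $$\underline\Phi\left(\left[\begin{smallmatrix}a&a&c\\ b&m&m\end{smallmatrix}\right]\right)=\sum_{y<b,\ a\ne y\ne c}\left[\begin{smallmatrix}a&a&c\\ y&b&b\end{smallmatrix}\right]-\sum_{b<x<m,\ a\ne x\ne c}\left[\begin{smallmatrix}a&a&c\\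 b&x&x\end{smallmatrix}\right].$$ (iv) $\left[\begin{smallmatrix}a&c&c\\ b&b&m\end{smallmatrix}\right]$ for $a<c\le m-1\ge b$, $a\ne b\ne c$ and either $c<m-1$ or $c=m-1>b+1$, with $\underline\Phi$-image $$\underline\Phi\left(\left[\begin{smallmatrix}a&c&c\\ b&b&m\end{smallmatrix}\right]\right)=\sum_{b<x<m,\ a\ne x\ne c}\left[\begin{smallmatrix}a&a&c\\ b&x&x\end{smallmatrix}\right]-\sum_{y<b,\ a\ne y\ne c}\left[\begin{smallmatrix}a&a&c\\ y&b&b\end{smallmatrix}\right].$$
   Context: Coefficients are in a commutative unital ring $R$; $V_m=\{1,\ldots,m\}$. The complex $C_m$ (a simplicial model of the configuration space of two points on the complete graph on $V_m$): vertices are columns $\begin{smallmatrix}a\\ b\end{smallmatrix}$ with $a,b\in V_m$, $a\ne b$; $k$-faces are arrays $\left[\begin{smallmatrix}a_0&\cdots&a_k\\ b_0&\cdots&b_k\end{smallmatrix}\right]$ with weakly increasing rows, $a_j\ne b_j$, consecutive columns distinct, and each row having at most two distinct entries. Faces are oriented by the displayed order of columns. Conditions making a displayed array a face are implicit. $C^*(C_m)$ is the simplicial cochain complex, with basis the duals of faces (denoted by the same symbols as the faces); the simplicial cup product on dual 1-faces is $[v_0,v_1]\smile[v_1,v_2]=[v_0,v_1,v_2]$ when the latter is a face, and all other products of dual 1-faces are zero. $W_m$ is the gradient field on $C_m$ with the following pairings (it is the one produced by the paper's algorithm): (a) $\left[\begin{smallmatrix}a&a\\ b&d\end{smallmatrix}\right]\nearrow\left[\begin{smallmatrix}a&a&m\\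 b&d&d\end{smallmatrix}\right]$, $a<m>d$; (b) $\left[\begin{smallmatrix}a&a\\ b&m\end{smallmatrix}\right]\nearrow\left[\begin{smallmatrix}a&a&m-1\\ b&m&m\end{smallmatrix}\right]$, $a<m-1$; (c) $\left[\begin{smallmatrix}a&c\\ b&b\end{smallmatrix}\right]\nearrow\left[\begin{smallmatrix}a&c&c\\ b&b&m\end{smallmatrix}\right]$, $b<m>c$; (d) $\left[\begin{smallmatrix}a&m\\ b&b\end{smallmatrix}\right]\nearrow\left[\begin{smallmatrix}a&m&m\\ b&b&m-1\end{smallmatrix}\right]$, $b<m-1$; (e) $\left[\begin{smallmatrix}a&c\\ b&d\end{smallmatrix}\right]\nearrow\left[\begin{smallmatrix}a&c&c\\ b&b&d\end{smallmatrix}\right]$, $a<c$, $b<d$, $b\ne c$ and either $c<m>d$ or $c=m>d+1$; (f) $\left[\begin{smallmatrix}a&c\\ b&d\end{smallmatrix}\right]\nearrow\left[\begin{smallmatrix}a&a&c\\ b&d&d\end{smallmatrix}\right]$, $a<c$, $b<d$, $a\ne d$ and either $b=c<m>d$ or $c+1<m=d$; (g) $\left[\begin{smallmatrix}a\\ b\end{smallmatrix}\right]\nearrow\left[\begin{smallmatrix}a&m\\ b&m-1\end{smallmatrix}\right]$, either $b<m-1$ or $a<m-1=b$; (h) $\left[\begin{smallmatrix}a\\ m\end{smallmatrix}\right]\nearrow\left[\begin{smallmatrix}a&m-1\\ m&m\end{smallmatrix}\right]$, $a<m-1$; (i) $\left[\begin{smallmatrix}m-1\\ m\end{smallmatrix}\right]\nearrow\left[\begin{smallmatrix}m-1&m-1\\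 m-2&m\end{smallmatrix}\right]$. Critical (unpaired) 1-faces: (k.1) $\left[\begin{smallmatrix}a&m-1\\ b&m\end{smallmatrix}\right]$ with $a=m-1>b+1$ or $a<m-1\ge b$; (k.2) $\left[\begin{smallmatrix}m&m\\ b&d\end{smallmatrix}\right]$ with $d<m-1$; (k.3) $\left[\begin{smallmatrix}a&c\\ m&m\end{smallmatrix}\right]$ with $c<m-1$. Critical 2-faces: $\left[\begin{smallmatrix}a&a&c\\ b&d&d\end{smallmatrix}\right]$ with $b\ne c<m>d$. $\mu^p(C_m)$ is the free $R$-module on (duals of) critical $p$-faces. For a codimension-one face $\alpha\subset\beta$, $\iota_{\alpha,\beta}=\pm1$ is the coefficient of $\alpha$ in $\partial\beta$, where $\partial[v_0,\ldots,v_i]=\sum_j(-1)^j[v_0,\ldots,\widehat{v_j},\ldots,v_i]$. Below, $\nearrow$ denotes a pair in $W_m$ and $\searrow$ a passage to a codimension-one face by an inclusion not in $W_m$. An upper path from $\beta$ to $\alpha$ is $\beta=\alpha_0\nearrow\beta_1\searrow\alpha_1\nearrow\cdots\nearrow\beta_k\searrow\alpha_k=\alpha$ ($k\ge0$), with multiplicity $\prod_{j=1}^k(-\iota_{\alpha_{j-1},\beta_j}\iota_{\alpha_j,\beta_j})$. A lower path from $\alpha$ to $\beta$ is $\alpha=\gamma_0\searrow\delta_1\nearrow\gamma_1\searrow\cdots\searrow\delta_k\nearrow\gamma_k=\beta$ ($k\ge0$), with multiplicity $\prod_{j=1}^k(-\iota_{\delta_j,\gamma_{j-1}}\iota_{\delta_j,\gamma_j})$.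 The cochain maps $\overline\Phi\colon\mu^*(C_m)\to C^*(C_m)$ and $\underline\Phi\colon C^*(C_m)\to\mu^*(C_m)$ are: $\overline\Phi(\alpha)=\sum_\beta(\sum_\lambda\mu(\lambda))\beta$ for $\alpha$ critical, $\beta$ over all faces of the same dimension, $\lambda$ over upper paths from $\beta$ to $\alpha$; and $\underline\Phi(\beta)=\sum_\alpha(\sum_\lambda\mu(\lambda))\alpha$ for $\beta$ arbitrary, $\alpha$ over critical faces of the same dimension, $\lambda$ over lower paths from $\alpha$ to $\beta$. *)

theory Defs
  imports Main
begin

(* A column (a, b) stands for the vertex with upper entry a and lower entry b;
   an array is the list of its columns, in the displayed order. *)
type_synonym face = "(nat \<times> nat) list"

definition vertices :: "nat \<Rightarrow> (nat \<times> nat) set" where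
  "vertices m = {(a, b). a \<in> {1..m} \<and> b \<in> {1..m} \<and> a \<noteq> b}"

definition faces :: "nat \<Rightarrow> nat \<Rightarrow> face set" where
  "faces m k = {\<sigma>. length \<sigma> = k + 1 \<and> set \<sigma> \<subseteq> vertices m
     \<and> sorted (map fst \<sigma>) \<and> sorted (map snd \<sigma>)
     \<and> (\<forall>i<k. \<sigma> ! i \<noteq> \<sigma> ! (i + 1))
     \<and> card (set (map fst \<sigma>)) \<le> 2 \<and> card (set (map snd \<sigma>)) \<le> 2}"

definition omit :: "nat \<Rightarrow> face \<Rightarrow> face" where
  "omit j \<sigma> = take j \<sigma> @ drop (Suc j) \<sigma>"

definition facets :: "nat \<Rightarrow> (face \<times> face) set" where
  "facets m = {(\<alpha>, \<beta>). \<exists>k. \<alpha> \<in> faces m k \<and> \<beta> \<in> faces m (k + 1)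
     \<and> (\<exists>j<length \<beta>. \<alpha> = omit j \<beta>)}"

(* The coefficient of \<alpha> in the boundary of \<beta>. *)
definition incidence :: "face \<Rightarrow> face \<Rightarrow> 'r::comm_ring_1" where
  "incidence \<alpha> \<beta> = (\<Sum>j<length \<beta>. if omit j \<beta> = \<alpha> then (-1) ^ j else 0)"

(* The pairing rules, before the implicit requirement that both arrays are faces. *)
inductive pairing :: "nat \<Rightarrow> face \<Rightarrow> face \<Rightarrow> bool" for m :: nat where
  pair_a: "a < m \<Longrightarrow> m > d \<Longrightarrow>
    pairing m [(a, b), (a, d)] [(a, b), (a, d), (m, d)]"
| pair_b: "a < m - 1 \<Longrightarrow>
    pairing m [(a, b), (a, m)] [(a, b), (a, m), (m - 1, m)]"
| pair_c: "b < m \<Longrightarrow> m > c \<Longrightarrow>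
    pairing m [(a, b), (c, b)] [(a, b), (c, b), (c, m)]"
| pair_d: "b < m - 1 \<Longrightarrow>
    pairing m [(a, b), (m, b)] [(a, b), (m, b), (m, m - 1)]"
| pair_e: "a < c \<Longrightarrow> b < d \<Longrightarrow> b \<noteq> c \<Longrightarrow>
    (c < m \<and> m > d) \<or> (c = m \<and> m > d + 1) \<Longrightarrow>
    pairing m [(a, b), (c, d)] [(a, b), (c, b), (c, d)]"
| pair_f: "a < c \<Longrightarrow> b < d \<Longrightarrow> a \<noteq> d \<Longrightarrow>
    (b = c \<and> c < m \<and> m > d) \<or> (c + 1 < m \<and> m = d) \<Longrightarrow>
    pairing m [(a, b), (c, d)] [(a, b), (a, d), (c, d)]"
| pair_g: "b < m - 1 \<or> (a < m - 1 \<and> m - 1 = b) \<Longrightarrow>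
    pairing m [(a, b)] [(a, b), (m, m - 1)]"
| pair_h: "a < m - 1 \<Longrightarrow>
    pairing m [(a, m)] [(a, m), (m - 1, m)]"
| pair_i: "pairing m [(m - 1, m)] [(m - 1, m - 2), (m - 1, m)]"

definition W :: "nat \<Rightarrow> (face \<times> face) set" where
  "W m = {(\<alpha>, \<beta>). (\<exists>k. \<alpha> \<in> faces m k \<and> \<beta> \<in> faces m (k + 1)) \<and> pairing m \<alpha> \<beta>}"

definition critical :: "nat \<Rightarrow> nat \<Rightarrow> face set" where
  "critical m k = {\<sigma> \<in> faces m k. \<forall>\<tau>. (\<sigma>, \<tau>) \<notin> W m \<and> (\<tau>, \<sigma>) \<notin> W m}"

(* Paths are recorded, apart from their starting face, as the list of their steps:
   an upper step \<open>(\<beta>\<^sub>j, \<alpha>\<^sub>j)\<close> goes up to \<open>\<beta>\<^sub>j\<close> and down to \<open>\<alpha>\<^sub>j\<close>, and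
   a lower step \<open>(\<delta>\<^sub>j, \<gamma>\<^sub>j)\<close> goes down to \<open>\<delta>\<^sub>j\<close> and up to \<open>\<gamma>\<^sub>j\<close>. *)
fun upper_path :: "nat \<Rightarrow> face \<Rightarrow> (face \<times> face) list \<Rightarrow> face \<Rightarrow> bool" where
  "upper_path m \<sigma> [] \<tau> \<longleftrightarrow> \<sigma> = \<tau>"
| "upper_path m \<sigma> ((\<beta>, \<alpha>) # p) \<tau> \<longleftrightarrow>
     (\<sigma>, \<beta>) \<in> W m \<and> (\<alpha>, \<beta>) \<in> facets m - W m \<and> upper_path m \<alpha> p \<tau>"

fun upper_mult :: "face \<Rightarrow> (face \<times> face) list \<Rightarrow> 'r::comm_ring_1" where
  "upper_mult \<sigma> [] = 1"
| "upper_mult \<sigma> ((\<beta>, \<alpha>) # p) = - (incidence \<sigma> \<beta> * incidence \<alpha> \<beta>) * upper_mult \<alpha> p"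

fun lower_path :: "nat \<Rightarrow> face \<Rightarrow> (face \<times> face) list \<Rightarrow> face \<Rightarrow> bool" where
  "lower_path m \<sigma> [] \<tau> \<longleftrightarrow> \<sigma> = \<tau>"
| "lower_path m \<sigma> ((\<delta>, \<gamma>) # p) \<tau> \<longleftrightarrow>
     (\<delta>, \<sigma>) \<in> facets m - W m \<and> (\<delta>, \<gamma>) \<in> W m \<and> lower_path m \<gamma> p \<tau>"

fun lower_mult :: "face \<Rightarrow> (face \<times> face) list \<Rightarrow> 'r::comm_ring_1" where
  "lower_mult \<sigma> [] = 1"
| "lower_mult \<sigma> ((\<delta>, \<gamma>) # p) = - (incidence \<delta> \<sigma> * incidence \<delta> \<gamma>) * lower_mult \<gamma> p"

(* A cochain is given by its coefficients with respect to the basis of dual faces.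
   The Morse cochains of degree k are those supported on the critical k-faces. *)
type_synonym 'r cochain = "face \<Rightarrow> 'r"

definition dual :: "face \<Rightarrow> 'r::comm_ring_1 cochain" where
  "dual \<sigma> = (\<lambda>\<tau>. if \<tau> = \<sigma> then 1 else 0)"

(* Linear extensions, in degree k, of the two maps given on dual faces. Both sets of
   paths are finite, since the gradient field is acyclic and the complex is finite. *)
definition upper_Phi :: "nat \<Rightarrow> nat \<Rightarrow> 'r::comm_ring_1 cochain \<Rightarrow> 'r cochain" where
  "upper_Phi m k f = (\<lambda>\<beta>. if \<beta> \<in> faces m k
     then \<Sum>\<alpha>\<in>critical m k. f \<alpha> * (\<Sum>p | upper_path m \<beta> p \<alpha>. upper_mult \<beta> p) else 0)"

definition lower_Phi :: "nat \<Rightarrow> nat \<Rightarrow> 'r::comm_ring_1 cochain \<Rightarrow> 'r cochain" where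
  "lower_Phi m k f = (\<lambda>\<alpha>. if \<alpha> \<in> critical m k
     then \<Sum>\<beta>\<in>faces m k. f \<beta> * (\<Sum>p | lower_path m \<alpha> p \<beta>. lower_mult \<alpha> p) else 0)"

(* The product of two dual 1-faces, and its bilinear extension. *)
definition cup_dual :: "nat \<Rightarrow> face \<Rightarrow> face \<Rightarrow> 'r::comm_ring_1 cochain" where
  "cup_dual m \<sigma> \<tau> =
     (if \<sigma> ! 1 = \<tau> ! 0 \<and> [\<sigma> ! 0, \<sigma> ! 1, \<tau> ! 1] \<in> faces m 2
      then dual [\<sigma> ! 0, \<sigma> ! 1, \<tau> ! 1] else (\<lambda>_. 0))"

definition cup :: "nat \<Rightarrow> 'r::comm_ring_1 cochain \<Rightarrow> 'r cochain \<Rightarrow> 'r cochain" where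
  "cup m f g = (\<lambda>\<rho>. \<Sum>\<sigma>\<in>faces m 1. \<Sum>\<tau>\<in>faces m 1. f \<sigma> * g \<tau> * cup_dual m \<sigma> \<tau> \<rho>)"

(* The side conditions of the four types of 2-faces. As the arrays have to be faces, all
   their entries are at least 1. *)
definition form_i :: "nat \<Rightarrow> nat \<Rightarrow> nat \<Rightarrow> nat \<Rightarrow> nat \<Rightarrow> bool" where
  "form_i m a b c d \<longleftrightarrow> [(a, b), (a, d), (c, d)] \<in> faces m 2
     \<and> a < c \<and> c < m \<and> m > d \<and> d > b \<and> b \<noteq> a \<and> a \<noteq> d \<and> d \<noteq> c"

definition form_ii :: "nat \<Rightarrow> nat \<Rightarrow> nat \<Rightarrow> nat \<Rightarrow> nat \<Rightarrow> bool" where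
  "form_ii m a b c d \<longleftrightarrow> [(a, b), (c, b), (c, d)] \<in> faces m 2
     \<and> a < c \<and> c \<le> m - 1 \<and> m - 1 > d \<and> d > b \<and> a \<noteq> b \<and> b \<noteq> c \<and> c \<noteq> d"

definition form_iii :: "nat \<Rightarrow> nat \<Rightarrow> nat \<Rightarrow> nat \<Rightarrow> bool" where
  "form_iii m a b c \<longleftrightarrow> [(a, b), (a, m), (c, m)] \<in> faces m 2
     \<and> a < c \<and> c < m - 1 \<and> m - 1 \<ge> b \<and> b \<noteq> a \<and> a \<noteq> m \<and> m \<noteq> c"

definition form_iv :: "nat \<Rightarrow> nat \<Rightarrow> nat \<Rightarrow> nat \<Rightarrow> bool" where
  "form_iv m a b c \<longleftrightarrow> [(a, b), (c, b), (c, m)] \<in> faces m 2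
     \<and> a < c \<and> c \<le> m - 1 \<and> m - 1 \<ge> b \<and> a \<noteq> b \<and> b \<noteq> c
     \<and> (c < m - 1 \<or> (c = m - 1 \<and> m - 1 > b + 1))"

end

theory Submission
  imports Defs
begin

text \<open>
  The sums over gradient paths are never enumerated; they are characterised by linear conditions.
  The gradient field matches faces with cofaces, and a rank on edges decreases along every step of a
  path. Splitting off the first step of a path hence gives a terminating recursion, and this yields
  two uniqueness principles. First, a cochain \<open>g\<close> equals the image of the dual of a critical face
  \<open>x\<close> under the upper map as soon as it agrees with this dual on all faces that are not
  paired upwards, and its coboundary vanishes on the upper face of every pair
  (\<open>upper_Phi_eqI\<close>). Secondly, if \<open>h\<close> is supported on the faces that are paired upwards and \<open>dual \<tau>\<close>
  minus the coboundary of \<open>h\<close> is supported on critical faces, then this difference is the image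
  of \<open>dual \<tau>\<close> under the lower map (\<open>lower_Phi_eqI\<close>).

  For the products, each kind of critical edge is represented by an explicit function on edges: the
  indicator of a bottom row, the indicator of a top row, or a function that compares the ends of the
  horizontal piece of a path around a corner. All of these have values \<open>0\<close>, \<open>1\<close> and \<open>-1\<close>. A triangle has the columns
  \<open>(a, b)\<close> and \<open>(c, d)\<close> with \<open>a < c\<close> and \<open>b < d\<close> at its ends and one of the two other corners of this
  rectangle in the middle; a product of cocycles takes there the product of the values
  at the first and the last edge. The common zeros of the representing functions leave just
  the four types of triangles (\<open>product_support\<close>).

  For the reduction of these triangles, the coboundary of the dual of a diagonal edge is, up to sign,
  the sum of the two triangles over it, which exchanges the two corners of a rectangle. As
  critical triangles pass through \<open>(a, d)\<close>, this treats the triangles without an entry \<open>m\<close>. The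
  triangle from \<open>(a, b)\<close> through \<open>(c, b)\<close> to \<open>(c, m)\<close> is reduced by the coboundary of all edges
  with top row \<open>a\<close>, \<open>c\<close> that run at height \<open>b\<close>: on the triangles that remain, this coboundary
  compares two heights, whence the two sums with opposite signs (\<open>coboundary_sweep\<close>). The
  remaining type is related to this one by the diagonal from \<open>(a, b)\<close> to \<open>(c, m)\<close>.
\<close>

section \<open>Faces as chains of columns\<close>

text \<open>Faces are exactly the chains of this strict order that use at most two values in each row.
  As the order is transitive, deleting a column keeps a chain, and chains have no repetitions.\<close>
definition column_less :: "nat \<times> nat \<Rightarrow> nat \<times> nat \<Rightarrow> bool" where
  "column_less v w \<longleftrightarrow> fst v \<le> fst w \<and> snd v \<le> snd w \<and> v \<noteq> w"

lemma faces_iff_chain: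
  "\<sigma> \<in> faces m k \<longleftrightarrow> length \<sigma> = k + 1 \<and> set \<sigma> \<subseteq> vertices m \<and> sorted_wrt column_less \<sigma>
     \<and> card (set (map fst \<sigma>)) \<le> 2 \<and> card (set (map snd \<sigma>)) \<le> 2"
proof -
  have trans: "transp column_less"
    by (auto simp: transp_def column_less_def prod_eq_iff)
  have trans_le: "transp ((\<le>) :: nat \<Rightarrow> nat \<Rightarrow> bool)"
    by (auto simp: transp_def)
  have "sorted_wrt column_less \<sigma> \<longleftrightarrow>
      sorted (map fst \<sigma>) \<and> sorted (map snd \<sigma>) \<and> (\<forall>i<k. \<sigma> ! i \<noteq> \<sigma> ! (i + 1))"
    if "length \<sigma> = k + 1"
    unfolding sorted_wrt_iff_nth_Suc_transp[OF trans] sorted_wrt_iff_nth_Suc_transp[OF trans_le]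
    using that by (auto simp: column_less_def)
  then show ?thesis
    unfolding faces_def by auto
qed

lemma length_face: "\<sigma> \<in> faces m k \<Longrightarrow> length \<sigma> = k + 1"
  by (simp add: faces_def)

lemma distinct_face:
  assumes "\<sigma> \<in> faces m k"
  shows "distinct \<sigma>"
proof -
  have "sorted_wrt (\<noteq>) \<sigma>"
    using assms by (auto simp: faces_iff_chain column_less_def elim!: sorted_wrt_mono_rel[rotated])
  then show ?thesis
    by (simp add: distinct_conv_nth sorted_wrt_iff_nth_less) (metis nat_neq_iff)
qed

lemma finite_faces: "finite (faces m k)"
proof (rule finite_subset)
  show "faces m k \<subseteq> {\<sigma>. set \<sigma> \<subseteq> {1..m} \<times> {1..m} \<and> length \<sigma> = k + 1}"
    by (auto simp: faces_def vertices_def)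
qed (simp add: finite_lists_length_eq)

lemma set_omit:
  assumes "distinct \<sigma>" "j < length \<sigma>"
  shows "set (omit j \<sigma>) = set \<sigma> - {\<sigma> ! j}"
proof -
  have "distinct (take j \<sigma> @ \<sigma> ! j # drop (Suc j) \<sigma>)"
    using assms by (simp add: id_take_nth_drop[symmetric])
  moreover have "set \<sigma> = set (take j \<sigma> @ \<sigma> ! j # drop (Suc j) \<sigma>)"
    using assms by (simp add: id_take_nth_drop[symmetric])
  ultimately show ?thesis
    by (auto simp: omit_def)
qed

lemma omit_eq_iff:
  assumes "distinct \<sigma>" "i < length \<sigma>" "j < length \<sigma>"
  shows "omit i \<sigma> = omit j \<sigma> \<longleftrightarrow> i = j"
  by (metis assms set_omit Diff_iff insertI1 nth_eq_iff_index_eq nth_mem singletonD)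

lemma omit_face:
  assumes "\<beta> \<in> faces m (k + 1)" "j < length \<beta>"
  shows "omit j \<beta> \<in> faces m k"
proof -
  have sub: "set (omit j \<beta>) \<subseteq> set \<beta>"
    by (auto simp: omit_def dest: in_set_takeD in_set_dropD)
  have "sorted_wrt column_less (take j \<beta> @ \<beta> ! j # drop (Suc j) \<beta>)"
    using assms by (simp add: faces_iff_chain id_take_nth_drop[symmetric])
  then have "sorted_wrt column_less (omit j \<beta>)"
    by (auto simp: omit_def sorted_wrt_append)
  moreover have "card (set (map f (omit j \<beta>))) \<le> card (set (map f \<beta>))" for f :: "nat \<times> nat \<Rightarrow> nat"
    using sub by (intro card_mono) auto
  ultimately show ?thesis
    using assms sub unfolding faces_iff_chain
    by (auto simp: omit_def intro: order_trans)
qed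

lemma facets_of_face:
  assumes "\<beta> \<in> faces m (k + 1)"
  shows "{\<alpha>. (\<alpha>, \<beta>) \<in> facets m} = (\<lambda>j. omit j \<beta>) ` {..<length \<beta>}"
  using assms omit_face[OF assms] by (auto simp: facets_def dest: length_face)

lemma facet_face:
  assumes "\<beta> \<in> faces m (k + 1)" "(\<alpha>, \<beta>) \<in> facets m"
  shows "\<alpha> \<in> faces m k"
proof -
  obtain k' where "\<alpha> \<in> faces m k'" "\<beta> \<in> faces m (k' + 1)"
    using assms by (auto simp: facets_def)
  moreover from this have "k' = k"
    using length_face[of \<beta> m "k' + 1"] length_face[of \<beta> m "k + 1"] assms by simp
  ultimately show ?thesis
    by simp
qed

lemma incidence_omit:
  assumes "distinct \<beta>" "j < length \<beta>"
  shows "incidence (omit j \<beta>) \<beta> = ((-1) ^ j :: 'r::comm_ring_1)"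
proof -
  have "incidence (omit j \<beta>) \<beta> = (\<Sum>i<length \<beta>. if i = j then (-1) ^ i else (0::'r))"
    unfolding incidence_def using assms by (intro sum.cong) (auto simp: omit_eq_iff)
  then show ?thesis
    using assms by simp
qed

lemma incidence_square:
  assumes "\<beta> \<in> faces m (k + 1)" "(\<alpha>, \<beta>) \<in> facets m"
  shows "incidence \<alpha> \<beta> * incidence \<alpha> \<beta> = (1 :: 'r::comm_ring_1)"
proof -
  obtain j where "j < length \<beta>" "\<alpha> = omit j \<beta>"
    using assms facets_of_face by blast
  then show ?thesis
    using assms by (simp add: incidence_omit distinct_face flip: power_mult_distrib)
qed

text \<open>The classical alternating formula. On faces it agrees with the sum over
  all facets weighted by incidence numbers, since different omissions give different facets.\<close>
definition coboundary :: "'r::comm_ring_1 cochain \<Rightarrow> 'r cochain" where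
  "coboundary g \<beta> = (\<Sum>j<length \<beta>. (-1) ^ j * g (omit j \<beta>))"

lemma coboundary_facets:
  fixes g :: "'r::comm_ring_1 cochain"
  assumes "\<beta> \<in> faces m (k + 1)"
  shows "coboundary g \<beta> = (\<Sum>\<alpha> | (\<alpha>, \<beta>) \<in> facets m. incidence \<alpha> \<beta> * g \<alpha>)"
proof -
  have "inj_on (\<lambda>j. omit j \<beta>) {..<length \<beta>}"
    using assms by (auto simp: inj_on_def omit_eq_iff dest: distinct_face)
  then show ?thesis
    unfolding facets_of_face[OF assms] coboundary_def
    using assms by (simp add: sum.reindex incidence_omit distinct_face)
qed

lemma finite_facets:
  assumes "\<beta> \<in> faces m (k + 1)"
  shows "finite {\<alpha>. (\<alpha>, \<beta>) \<in> facets m}"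
  by (simp add: facets_of_face[OF assms])

lemma edge_iff:
  "[(a, b), (c, d)] \<in> faces m (Suc 0) \<longleftrightarrow>
     1 \<le> a \<and> a \<le> c \<and> c \<le> m \<and> 1 \<le> b \<and> b \<le> d \<and> d \<le> m \<and> a \<noteq> b \<and> c \<noteq> d \<and> (a < c \<or> b < d)"
  by (auto simp: faces_iff_chain vertices_def column_less_def card_insert_if)

text \<open>A triangle changes both rows, because a row with two values and a constant row only allow two
  distinct columns. So the middle column is one of the two other corners of the rectangle
  spanned by the outer columns.\<close>
lemma triangle_iff:
  "[(a, b), (c, d), (e, f)] \<in> faces m (Suc (Suc 0)) \<longleftrightarrow>
     1 \<le> a \<and> a < e \<and> e \<le> m \<and> 1 \<le> b \<and> b < f \<and> f \<le> m \<and> a \<noteq> b \<and> c \<noteq> d \<and> e \<noteq> f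
       \<and> (c = a \<and> d = f \<or> c = e \<and> d = b)"
  by (auto simp: faces_iff_chain vertices_def column_less_def card_insert_if split: if_splits)

lemma point_iff:
  "[(a, b)] \<in> faces m 0 \<longleftrightarrow> 1 \<le> a \<and> a \<le> m \<and> 1 \<le> b \<and> b \<le> m \<and> a \<noteq> b"
  by (auto simp: faces_iff_chain vertices_def column_less_def)

section \<open>Gradient paths\<close>

lemma W_degree:
  assumes "(\<sigma>, \<beta>) \<in> W m"
  shows "\<sigma> \<in> faces m (length \<sigma> - 1)" "\<beta> \<in> faces m (length \<sigma>)" "length \<sigma> > 0"
proof -
  obtain k where "\<sigma> \<in> faces m k" "\<beta> \<in> faces m (k + 1)"
    using assms by (auto simp: W_def)
  then show "\<sigma> \<in> faces m (length \<sigma> - 1)" "\<beta> \<in> faces m (length \<sigma>)" "length \<sigma> > 0"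
    by (simp_all add: length_face)
qed

lemma W_pairing: "(\<sigma>, \<beta>) \<in> W m \<Longrightarrow> pairing m \<sigma> \<beta>"
  by (simp add: W_def)

text \<open>The conditions on faces contain many disequalities of entries, and linear arithmetic splits on
  each of them; the limit prevents an exponential number of cases.\<close>
declare [[linarith_neq_limit = 1]]

text \<open>Together with \<open>W_injective\<close>: the gradient field is a matching of faces with cofaces, so a path
  can only branch when it goes down.\<close>
lemma W_functional:
  assumes "(\<sigma>, \<beta>) \<in> W m" "(\<sigma>, \<beta>') \<in> W m"
  shows "\<beta> = \<beta>'"
  using W_pairing[OF assms(1)] W_pairing[OF assms(2)] W_degree[OF assms(1)] W_degree(2)[OF assms(2)]
  by - (erule pairing.cases[of m \<sigma> \<beta>]; hypsubst; erule pairing.cases;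
      auto simp add: edge_iff triangle_iff point_iff)

lemma W_injective:
  assumes "(\<sigma>, \<beta>) \<in> W m" "(\<sigma>', \<beta>) \<in> W m"
  shows "\<sigma> = \<sigma>'"
  using W_pairing[OF assms(1)] W_pairing[OF assms(2)] W_degree[OF assms(1)] W_degree[OF assms(2)]
  by - (erule pairing.cases[of m \<sigma> \<beta>]; hypsubst; erule pairing.cases;
      auto simp add: edge_iff triangle_iff point_iff)

lemma W_facet:
  assumes "(\<sigma>, \<beta>) \<in> W m"
  shows "(\<sigma>, \<beta>) \<in> facets m"
proof -
  have "\<exists>j<length \<beta>. \<sigma> = omit j \<beta>"
    using W_pairing[OF assms]
  proof cases
  qed ((rule exI[of _ 2], force simp: omit_def) | (rule exI[of _ 1], force simp: omit_def)
      | (rule exI[of _ 0], force simp: omit_def))+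
  then show ?thesis
    using assms by (auto simp: facets_def W_def)
qed

text \<open>A witness for acyclicity in degree \<open>k\<close>: it bounds the length of upper paths, and also of lower
  paths one degree higher, as both types alternate between the same pairs and inclusions.\<close>
definition descending :: "nat \<Rightarrow> nat \<Rightarrow> (face \<Rightarrow> nat) \<Rightarrow> bool" where
  "descending m k r \<longleftrightarrow> (\<forall>\<sigma>\<in>faces m k. \<forall>\<beta> \<alpha>.
     (\<sigma>, \<beta>) \<in> W m \<longrightarrow> (\<alpha>, \<beta>) \<in> facets m - W m \<longrightarrow> r \<alpha> < r \<sigma>)"

text \<open>Path sums are computed by splitting off the first step. Finiteness has to be carried along,
  because sums over infinite sets are zero by convention.\<close>
lemma sum_over_first_step:
  fixes f :: "'a list \<Rightarrow> 'r::comm_monoid_add"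
  assumes "finite T" and "\<And>t. t \<in> T \<Longrightarrow> finite (P t)"
    and "X = (if b then {[]} else {}) \<union> (\<Union>t\<in>T. (#) t ` P t)"
  shows "finite X"
    and "sum f X = (if b then f [] else 0) + (\<Sum>t\<in>T. \<Sum>p\<in>P t. f (t # p))"
proof -
  show "finite X"
    using assms by auto
  have "sum f (\<Union>t\<in>T. (#) t ` P t) = (\<Sum>t\<in>T. \<Sum>p\<in>P t. f (t # p))"
    using assms(1,2) by (subst sum.UNION_disjoint) (auto simp: sum.reindex)
  moreover have "sum f X = sum f (if b then {[]} else {}) + sum f (\<Union>t\<in>T. (#) t ` P t)"
    unfolding assms(3) using assms(1,2) by (intro sum.union_disjoint) auto
  ultimately show "sum f X = (if b then f [] else 0) + (\<Sum>t\<in>T. \<Sum>p\<in>P t. f (t # p))"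
    by simp
qed

lemma facets_remove_partner:
  assumes "(\<sigma>, \<beta>) \<in> W m"
  shows "{\<alpha>. (\<alpha>, \<beta>) \<in> facets m - W m} = {\<alpha>. (\<alpha>, \<beta>) \<in> facets m} - {\<sigma>}"
  using assms by (auto dest: W_injective)

text \<open>The facets of a paired face are its partner and the faces to which a path may descend.\<close>
lemma coboundary_split_partner:
  fixes g :: "'r::comm_ring_1 cochain"
  assumes "\<sigma> \<in> faces m k" "(\<sigma>, \<beta>) \<in> W m"
  shows "coboundary g \<beta> = incidence \<sigma> \<beta> * g \<sigma>
    + (\<Sum>\<alpha> | (\<alpha>, \<beta>) \<in> facets m - W m. incidence \<alpha> \<beta> * g \<alpha>)"
proof -
  have \<beta>: "\<beta> \<in> faces m (k + 1)"
    using assms W_degree(2)[of \<sigma> \<beta> m] by (simp add: length_face)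
  show ?thesis
    unfolding coboundary_facets[OF \<beta>] facets_remove_partner[OF assms(2)]
    using W_facet[OF assms(2)] finite_facets[OF \<beta>] by (subst sum.remove[of _ \<sigma>]) auto
qed

text \<open>Splitting off the first step, the sum over upper paths from \<open>\<sigma>\<close>, paired with \<open>\<beta>\<close>, is a signed
  sum of the values at the other facets of \<open>\<beta>\<close>. As the incidence of \<open>\<sigma>\<close> in \<open>\<beta>\<close> is a sign, this
  recursion says precisely that the coboundary of the path sum vanishes at \<open>\<beta>\<close>. Since the
  recursion terminates, its solution \<open>g\<close> is unique.\<close>
lemma upper_coefficient_eqI:
  fixes g :: "'r::comm_ring_1 cochain"
  assumes r: "descending m k r" and \<tau>: "\<tau> \<in> critical m k" and \<sigma>: "\<sigma> \<in> faces m k"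
    and unpaired: "\<And>\<sigma>. \<sigma> \<in> faces m k \<Longrightarrow> \<forall>\<beta>. (\<sigma>, \<beta>) \<notin> W m \<Longrightarrow> g \<sigma> = dual \<tau> \<sigma>"
    and cocycle: "\<And>\<sigma> \<beta>. \<sigma> \<in> faces m k \<Longrightarrow> (\<sigma>, \<beta>) \<in> W m \<Longrightarrow> coboundary g \<beta> = 0"
  shows "finite {p. upper_path m \<sigma> p \<tau>} \<and> (\<Sum>p | upper_path m \<sigma> p \<tau>. upper_mult \<sigma> p) = g \<sigma>"
  using \<sigma>
proof (induction \<sigma> rule: measure_induct_rule[of r])
  case (less \<sigma>)
  show ?case
  proof (cases "\<exists>\<beta>. (\<sigma>, \<beta>) \<in> W m")
    case False
    then have "upper_path m \<sigma> p \<tau> \<longleftrightarrow> p = [] \<and> \<sigma> = \<tau>" for p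
      by (cases p) auto
    then show ?thesis
      using unpaired[OF less.prems] False by (auto simp: dual_def)
  next
    case True
    then obtain \<beta> where \<beta>: "(\<sigma>, \<beta>) \<in> W m"
      by blast
    have \<beta>_face: "\<beta> \<in> faces m (k + 1)"
      using less.prems W_degree(2)[OF \<beta>] by (simp add: length_face)
    define A where "A = {\<alpha>. (\<alpha>, \<beta>) \<in> facets m - W m}"
    have A: "finite A"
      unfolding A_def by (rule finite_subset[OF _ finite_facets[OF \<beta>_face]]) auto
    have IH: "finite {p. upper_path m \<alpha> p \<tau>}"
        "(\<Sum>p | upper_path m \<alpha> p \<tau>. upper_mult \<alpha> p) = g \<alpha>" if "\<alpha> \<in> A" for \<alpha>
    proof -
      have "r \<alpha> < r \<sigma>" "\<alpha> \<in> faces m k"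
        using that r less.prems \<beta> facet_face[OF \<beta>_face] by (auto simp: descending_def A_def)
      then show "finite {p. upper_path m \<alpha> p \<tau>}"
          "(\<Sum>p | upper_path m \<alpha> p \<tau>. upper_mult \<alpha> p) = g \<alpha>"
        using less.IH by auto
    qed
    have "\<sigma> \<noteq> \<tau>"
      using \<tau> \<beta> by (auto simp: critical_def)
    then have paths: "{p. upper_path m \<sigma> p \<tau>} = (if False then {[]} else {})
        \<union> (\<Union>t\<in>Pair \<beta> ` A. (#) t ` {p. upper_path m (snd t) p \<tau>})"
    proof (intro equalityI subsetI)
      fix p
      assume p: "p \<in> {p. upper_path m \<sigma> p \<tau>}"
      then obtain t q where "p = t # q"
        using \<open>\<sigma> \<noteq> \<tau>\<close> by (cases p) auto
      then have t: "p = (fst t, snd t) # q" "(\<sigma>, fst t) \<in> W m" "snd t \<in> A"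
          "upper_path m (snd t) q \<tau>"
        using p W_functional[OF _ \<beta>] by (cases t; auto simp: A_def)+
      moreover have "fst t = \<beta>"
        using W_functional[OF t(2) \<beta>] .
      ultimately show "p \<in> (if False then {[]} else {})
        \<union> (\<Union>t\<in>Pair \<beta> ` A. (#) t ` {p. upper_path m (snd t) p \<tau>})"
        by force
    qed (use \<beta> in \<open>auto simp: A_def\<close>)
    have fin: "finite {p. upper_path m \<sigma> p \<tau>}"
      using A IH(1) by (intro sum_over_first_step(1)[OF _ _ paths]) auto
    have "(\<Sum>p | upper_path m \<sigma> p \<tau>. upper_mult \<sigma> p)
        = (\<Sum>t\<in>Pair \<beta> ` A. \<Sum>p | upper_path m (snd t) p \<tau>. upper_mult \<sigma> (t # p))"
      using A IH(1) by (subst sum_over_first_step(2)[OF _ _ paths]) auto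
    also have "\<dots> = (\<Sum>\<alpha>\<in>A. - incidence \<sigma> \<beta> * (incidence \<alpha> \<beta> * g \<alpha>))"
    proof -
      have "(\<Sum>p | upper_path m \<alpha> p \<tau>. upper_mult \<sigma> ((\<beta>, \<alpha>) # p))
          = - incidence \<sigma> \<beta> * (incidence \<alpha> \<beta> * g \<alpha>)" if "\<alpha> \<in> A" for \<alpha>
        by (simp add: sum_distrib_left mult.assoc sum_negf flip: IH(2)[OF that])
      then show ?thesis
        by (simp add: sum.reindex inj_on_def)
    qed
    also have "\<dots> = - incidence \<sigma> \<beta> * (coboundary g \<beta> - incidence \<sigma> \<beta> * g \<sigma>)"
      by (simp add: coboundary_split_partner[OF less.prems \<beta>] A_def sum_distrib_left sum_negf)
    also have "\<dots> = g \<sigma>"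
      using cocycle[OF less.prems \<beta>] incidence_square[OF \<beta>_face W_facet[OF \<beta>], where 'r = 'r]
      by (simp flip: mult.assoc)
    finally show ?thesis
      using fin by blast
  qed
qed

lemma upper_Phi_eqI:
  fixes g :: "'r::comm_ring_1 cochain"
  assumes "descending m k r" "\<tau> \<in> critical m k"
    and "\<And>\<sigma>. \<sigma> \<in> faces m k \<Longrightarrow> \<forall>\<beta>. (\<sigma>, \<beta>) \<notin> W m \<Longrightarrow> g \<sigma> = dual \<tau> \<sigma>"
    and "\<And>\<sigma> \<beta>. \<sigma> \<in> faces m k \<Longrightarrow> (\<sigma>, \<beta>) \<in> W m \<Longrightarrow> coboundary g \<beta> = 0"
  shows "upper_Phi m k (dual \<tau>) = (\<lambda>\<sigma>. if \<sigma> \<in> faces m k then g \<sigma> else 0)"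
proof
  fix \<sigma>
  have fin: "finite (critical m k)"
    by (rule finite_subset[OF _ finite_faces[of m k]]) (auto simp: critical_def)
  have "(\<Sum>\<alpha>\<in>critical m k. dual \<tau> \<alpha> * (\<Sum>p | upper_path m \<sigma> p \<alpha>. upper_mult \<sigma> p))
      = (\<Sum>p | upper_path m \<sigma> p \<tau>. upper_mult \<sigma> p :: 'r)"
    using fin assms(2) by (simp add: dual_def if_distrib[of "\<lambda>x. x * _"] cong: if_cong)
  then show "upper_Phi m k (dual \<tau>) \<sigma> = (if \<sigma> \<in> faces m k then g \<sigma> else 0)"
    using conjunct2[OF upper_coefficient_eqI[OF assms(1,2), of \<sigma> g]] assms(3,4)
    by (simp add: upper_Phi_def)
qed

text \<open>The first step of a lower path. The cochain \<open>h\<close> records, on each face that is paired with a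
  coface, the path sum of this coface multiplied by the incidence of the pair; multiplying
  once more by this sign recovers the path sum.\<close>
lemma lower_paths_sum:
  fixes h :: "'r::comm_ring_1 cochain"
  assumes \<gamma>: "\<gamma> \<in> faces m (k + 1)"
    and unpaired: "\<And>\<delta>. \<delta> \<in> faces m k \<Longrightarrow> \<forall>\<beta>. (\<delta>, \<beta>) \<notin> W m \<Longrightarrow> h \<delta> = 0"
    and next_step: "\<And>\<delta> \<gamma>'. (\<delta>, \<gamma>) \<in> facets m - W m \<Longrightarrow> (\<delta>, \<gamma>') \<in> W m \<Longrightarrow>
      finite {p. lower_path m \<gamma>' p \<tau>}
      \<and> (\<Sum>p | lower_path m \<gamma>' p \<tau>. lower_mult \<gamma>' p) = incidence \<delta> \<gamma>' * h \<delta>"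
  shows "finite {p. lower_path m \<gamma> p \<tau>}
    \<and> (\<Sum>p | lower_path m \<gamma> p \<tau>. lower_mult \<gamma> p)
      = dual \<tau> \<gamma> - (\<Sum>\<delta> | (\<delta>, \<gamma>) \<in> facets m - W m. incidence \<delta> \<gamma> * h \<delta>)"
proof -
  define D where "D = {\<delta>. (\<delta>, \<gamma>) \<in> facets m - W m \<and> (\<exists>\<gamma>'. (\<delta>, \<gamma>') \<in> W m)}"
  define up where "up \<delta> = (SOME \<gamma>'. (\<delta>, \<gamma>') \<in> W m)" for \<delta>
  have up: "(\<delta>, up \<delta>) \<in> W m" if "\<delta> \<in> D" for \<delta>
    using that unfolding D_def up_def by (auto intro: someI)
  have D: "finite D"
    unfolding D_def by (rule finite_subset[OF _ finite_facets[OF \<gamma>]]) auto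
  have paths: "{p. lower_path m \<gamma> p \<tau>} = (if \<gamma> = \<tau> then {[]} else {})
      \<union> (\<Union>t\<in>(\<lambda>\<delta>. (\<delta>, up \<delta>)) ` D. (#) t ` {p. lower_path m (snd t) p \<tau>})"
  proof (intro equalityI subsetI)
    fix p
    assume "p \<in> {p. lower_path m \<gamma> p \<tau>}"
    then show "p \<in> (if \<gamma> = \<tau> then {[]} else {})
      \<union> (\<Union>t\<in>(\<lambda>\<delta>. (\<delta>, up \<delta>)) ` D. (#) t ` {p. lower_path m (snd t) p \<tau>})"
    proof (cases p)
      case (Cons t q)
      then have t: "fst t \<in> D" "(fst t, snd t) \<in> W m" "lower_path m (snd t) q \<tau>"
        using \<open>p \<in> _\<close> by (cases t; auto simp: D_def)+
      then have "t = (fst t, up (fst t))"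
        using W_functional[OF t(2) up[OF t(1)]] by (simp add: prod_eq_iff)
      then have "t \<in> (\<lambda>\<delta>. (\<delta>, up \<delta>)) ` D"
        using t(1) by (metis imageI)
      moreover have "p \<in> (#) t ` {p. lower_path m (snd t) p \<tau>}"
        using Cons t(3) by simp
      ultimately show ?thesis
        by blast
    qed (use \<open>p \<in> _\<close> in auto)
  next
    fix p
    assume "p \<in> (if \<gamma> = \<tau> then {[]} else {})
      \<union> (\<Union>t\<in>(\<lambda>\<delta>. (\<delta>, up \<delta>)) ` D. (#) t ` {p. lower_path m (snd t) p \<tau>})"
    then consider "p = []" "\<gamma> = \<tau>"
      | \<delta> q where "\<delta> \<in> D" "p = (\<delta>, up \<delta>) # q" "lower_path m (up \<delta>) q \<tau>"
      by (auto split: if_splits)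
    then show "p \<in> {p. lower_path m \<gamma> p \<tau>}"
    proof cases
      case (2 \<delta> q)
      then show ?thesis
        using up[OF \<open>\<delta> \<in> D\<close>] by (auto simp: D_def)
    qed simp
  qed
  have IH: "finite {p. lower_path m (up \<delta>) p \<tau>}"
      "(\<Sum>p | lower_path m (up \<delta>) p \<tau>. lower_mult (up \<delta>) p) = incidence \<delta> (up \<delta>) * h \<delta>"
    if "\<delta> \<in> D" for \<delta>
    using next_step[of \<delta> "up \<delta>"] up[OF that] that by (auto simp: D_def)
  have fin: "finite {p. lower_path m \<gamma> p \<tau>}"
    using D IH(1) by (intro sum_over_first_step(1)[OF _ _ paths]) auto
  have "(\<Sum>p | lower_path m \<gamma> p \<tau>. lower_mult \<gamma> p) = dual \<tau> \<gamma>
      + (\<Sum>t\<in>(\<lambda>\<delta>. (\<delta>, up \<delta>)) ` D. \<Sum>p | lower_path m (snd t) p \<tau>. lower_mult \<gamma> (t # p))"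
    using D IH(1) by (subst sum_over_first_step(2)[OF _ _ paths]) (auto simp: dual_def)
  also have "(\<Sum>t\<in>(\<lambda>\<delta>. (\<delta>, up \<delta>)) ` D. \<Sum>p | lower_path m (snd t) p \<tau>. lower_mult \<gamma> (t # p))
      = - (\<Sum>\<delta>\<in>D. incidence \<delta> \<gamma> * h \<delta>)"
  proof -
    have "(\<Sum>p | lower_path m (up \<delta>) p \<tau>. lower_mult \<gamma> ((\<delta>, up \<delta>) # p))
        = - (incidence \<delta> \<gamma> * h \<delta>)" if "\<delta> \<in> D" for \<delta>
    proof -
      have "(\<Sum>p | lower_path m (up \<delta>) p \<tau>. lower_mult \<gamma> ((\<delta>, up \<delta>) # p))
          = - (incidence \<delta> \<gamma> * ((incidence \<delta> (up \<delta>) * incidence \<delta> (up \<delta>)) * h \<delta>))"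
        by (simp add: sum_distrib_left mult.assoc sum_negf flip: IH(2)[OF that])
      moreover have "up \<delta> \<in> faces m (k + 1)"
        using that up[OF that] facet_face[OF \<gamma>] W_degree(2)[OF up[OF that]] length_face
        by (fastforce simp: D_def)
      ultimately show ?thesis
        using incidence_square[of "up \<delta>" m k \<delta>, where 'r = 'r] W_facet[OF up[OF that]] by simp
    qed
    then show ?thesis
      by (simp add: sum.reindex inj_on_def sum_negf)
  qed
  \<comment> \<open>Facets at which no path can go on contribute nothing, because \<open>h\<close> vanishes there.\<close>
  also have "(\<Sum>\<delta>\<in>D. incidence \<delta> \<gamma> * h \<delta>)
      = (\<Sum>\<delta> | (\<delta>, \<gamma>) \<in> facets m - W m. incidence \<delta> \<gamma> * h \<delta>)"
  proof (intro sum.mono_neutral_left ballI)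
    show "finite {\<delta>. (\<delta>, \<gamma>) \<in> facets m - W m}"
      by (rule finite_subset[OF _ finite_facets[OF \<gamma>]]) auto
  next
    fix \<delta>
    assume "\<delta> \<in> {\<delta>. (\<delta>, \<gamma>) \<in> facets m - W m} - D"
    then have "h \<delta> = 0"
      using facet_face[OF \<gamma>] by (intro unpaired) (auto simp: D_def)
    then show "incidence \<delta> \<gamma> * h \<delta> = 0"
      by simp
  qed (auto simp: D_def)
  finally show ?thesis
    using fin by simp
qed

text \<open>For a coface \<open>\<gamma>\<close> with partner \<open>\<delta>\<close>, the first step must avoid \<open>\<delta>\<close>. The condition on the
  coboundary at \<open>\<gamma>\<close> then turns the remaining sum into the term of \<open>\<delta>\<close>.\<close>
lemma lower_coefficient_of_target:
  fixes h :: "'r::comm_ring_1 cochain"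
  assumes r: "descending m k r" and \<delta>: "\<delta> \<in> faces m k" "(\<delta>, \<gamma>) \<in> W m"
    and unpaired: "\<And>\<delta>. \<delta> \<in> faces m k \<Longrightarrow> \<forall>\<beta>. (\<delta>, \<beta>) \<notin> W m \<Longrightarrow> h \<delta> = 0"
    and target: "\<And>\<delta> \<gamma>. \<delta> \<in> faces m k \<Longrightarrow> (\<delta>, \<gamma>) \<in> W m \<Longrightarrow> coboundary h \<gamma> = dual \<tau> \<gamma>"
  shows "finite {p. lower_path m \<gamma> p \<tau>}
    \<and> (\<Sum>p | lower_path m \<gamma> p \<tau>. lower_mult \<gamma> p) = incidence \<delta> \<gamma> * h \<delta>"
  using \<delta>
proof (induction \<delta> arbitrary: \<gamma> rule: measure_induct_rule[of r])
  case (less \<delta>)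
  have \<gamma>: "\<gamma> \<in> faces m (k + 1)"
    using less.prems W_degree(2)[of \<delta> \<gamma> m] by (simp add: length_face)
  have "finite {p. lower_path m \<gamma>' p \<tau>}
      \<and> (\<Sum>p | lower_path m \<gamma>' p \<tau>. lower_mult \<gamma>' p) = incidence \<delta>' \<gamma>' * h \<delta>'"
    if "(\<delta>', \<gamma>) \<in> facets m - W m" "(\<delta>', \<gamma>') \<in> W m" for \<delta>' \<gamma>'
  proof -
    have "r \<delta>' < r \<delta>" "\<delta>' \<in> faces m k"
      using that r less.prems facet_face[OF \<gamma>] by (auto simp: descending_def)
    then show ?thesis
      using less.IH that by blast
  qed
  from lower_paths_sum[OF \<gamma> unpaired this] show ?case
    using coboundary_split_partner[OF less.prems, of h] target[OF less.prems] by simp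
qed

text \<open>To reduce \<open>\<tau>\<close> to critical faces, subtract the coboundary of a cochain \<open>h\<close> that lives on the
  faces paired upwards, and choose \<open>h\<close> such that nothing is left away from the critical faces.
  What remains is the image of \<open>\<tau>\<close>: at a critical face all facets may begin a lower path, so the
  path sum is the full coboundary of \<open>h\<close>, up to sign and the trivial path.\<close>
lemma lower_Phi_eqI:
  fixes h R :: "'r::comm_ring_1 cochain"
  assumes r: "descending m k r" and \<tau>: "\<tau> \<in> faces m (k + 1)"
    and unpaired: "\<And>\<delta>. \<delta> \<in> faces m k \<Longrightarrow> \<forall>\<beta>. (\<delta>, \<beta>) \<notin> W m \<Longrightarrow> h \<delta> = 0"
    and R: "\<And>\<rho>. \<rho> \<in> faces m (k + 1) \<Longrightarrow> dual \<tau> \<rho> - coboundary h \<rho> = R \<rho>"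
    and support: "\<And>\<rho>. \<rho> \<notin> critical m (k + 1) \<Longrightarrow> R \<rho> = 0"
  shows "lower_Phi m (k + 1) (dual \<tau>) = R"
proof
  fix \<rho>
  show "lower_Phi m (k + 1) (dual \<tau>) \<rho> = R \<rho>"
  proof (cases "\<rho> \<in> critical m (k + 1)")
    case False
    then show ?thesis
      using support by (simp add: lower_Phi_def)
  next
    case True
    then have \<rho>: "\<rho> \<in> faces m (k + 1)" and no_partner: "\<And>\<delta>. (\<delta>, \<rho>) \<notin> W m"
      by (auto simp: critical_def)
    have target: "coboundary h \<gamma> = dual \<tau> \<gamma>" if "\<delta> \<in> faces m k" "(\<delta>, \<gamma>) \<in> W m" for \<delta> \<gamma>
    proof -
      have "\<gamma> \<in> faces m (k + 1)"
        using that W_degree(2)[of \<delta> \<gamma> m] by (simp add: length_face)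
      moreover have "\<gamma> \<notin> critical m (k + 1)"
        using that by (auto simp: critical_def)
      ultimately show ?thesis
        using R support by fastforce
    qed
    have "finite {p. lower_path m \<gamma>' p \<tau>}
        \<and> (\<Sum>p | lower_path m \<gamma>' p \<tau>. lower_mult \<gamma>' p) = incidence \<delta>' \<gamma>' * h \<delta>'"
      if "(\<delta>', \<rho>) \<in> facets m - W m" "(\<delta>', \<gamma>') \<in> W m" for \<delta>' \<gamma>'
      using that facet_face[OF \<rho>]
      by (intro lower_coefficient_of_target[OF r _ _ unpaired target]) auto
    from lower_paths_sum[OF \<rho> unpaired this]
    have "(\<Sum>p | lower_path m \<rho> p \<tau>. lower_mult \<rho> p) = dual \<tau> \<rho> - coboundary h \<rho>"
      using no_partner by (simp add: coboundary_facets[OF \<rho>])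
    moreover have "(\<Sum>\<beta>\<in>faces m (k + 1). dual \<tau> \<beta> * (\<Sum>p | lower_path m \<rho> p \<beta>. lower_mult \<rho> p))
        = (\<Sum>p | lower_path m \<rho> p \<tau>. lower_mult \<rho> p :: 'r)"
      using \<tau> finite_faces[of m "k + 1"]
      by (simp add: dual_def if_distrib[of "\<lambda>x. x * _"] cong: if_cong)
    ultimately show ?thesis
      using True R[OF \<rho>] by (simp add: lower_Phi_def)
  qed
qed

section \<open>The gradient field on edges and triangles\<close>

lemmas edge_simps = edge_iff edge_iff[folded One_nat_def]
lemmas triangle_simps = triangle_iff triangle_iff[folded numeral_2_eq_2]

lemma edge_cases:
  assumes "\<sigma> \<in> faces m 1"
  obtains a b c d where "\<sigma> = [(a, b), (c, d)]" "[(a, b), (c, d)] \<in> faces m 1"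
proof -
  obtain v w where "\<sigma> = [v, w]"
    using length_face[OF assms] by (auto simp: length_Suc_conv)
  then show thesis
    using that[of "fst v" "snd v" "fst w" "snd w"] assms by simp
qed

lemma triangle_cases:
  assumes "\<rho> \<in> faces m 2"
  obtains (upper) a b c d where "\<rho> = [(a, b), (a, d), (c, d)]" "[(a, b), (a, d), (c, d)] \<in> faces m 2"
    | (lower) a b c d where "\<rho> = [(a, b), (c, b), (c, d)]" "[(a, b), (c, b), (c, d)] \<in> faces m 2"
proof -
  obtain a b p q c d where \<rho>: "\<rho> = [(a, b), (p, q), (c, d)]"
    using length_face[OF assms] by (auto simp: length_Suc_conv numeral_2_eq_2)
  then have "(p, q) = (a, d) \<or> (p, q) = (c, b)"
    using assms by (auto simp: triangle_simps)
  then show thesis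
    using that \<rho> assms by auto
qed

lemma coboundary_triangle: "coboundary g [u, v, w] = g [v, w] - g [u, w] + g [u, v]"
  by (simp add: coboundary_def omit_def)

text \<open>The pairing rules leave out exactly the edges whose first vertex has an entry \<open>m\<close> and those
  that end at one of the two extremal vertices \<open>(m, m - 1)\<close> and \<open>(m - 1, m)\<close>.\<close>
lemma edge_source_iff:
  assumes "[(a, b), (c, d)] \<in> faces m 1"
  shows "(\<exists>\<beta>. ([(a, b), (c, d)], \<beta>) \<in> W m) \<longleftrightarrow>
    a < m \<and> b < m \<and> (c, d) \<noteq> (m, m - 1) \<and> (c, d) \<noteq> (m - 1, m)" (is "?L \<longleftrightarrow> ?R")
proof
  assume ?L
  then obtain \<beta> where \<beta>: "([(a, b), (c, d)], \<beta>) \<in> W m"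
    by blast
  show ?R
    using W_pairing[OF \<beta>] assms [[linarith_neq_limit = 2]]
    by cases (auto simp: edge_simps)
next
  assume R: ?R
  have face: "[(a, b), (c, d)] \<in> faces m (Suc 0)"
    using assms by simp
  have "\<exists>\<beta>. pairing m [(a, b), (c, d)] \<beta> \<and> \<beta> \<in> faces m 2"
  proof (cases "a = c \<or> b = d")
    case True
    consider "a = c" "d < m" | "a = c" "d = m" | "b = d" "c < m" | "b = d" "c = m"
      using True assms by (force simp: edge_simps)
    then show ?thesis
    proof cases
      case 1
      then show ?thesis
        using pair_a[of a m d b] R assms by (force simp: edge_simps triangle_simps)
    next
      case 2
      then show ?thesis
        using pair_b[of a m b] R assms
        by (cases "a < m - 1") (force simp: edge_simps triangle_simps)+
    next
      case 3
      then show ?thesis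
        using pair_c[of b m c a] R assms by (force simp: edge_simps triangle_simps)
    next
      case 4
      then show ?thesis
        using pair_d[of b m a] R assms
        by (cases "b < m - 1") (force simp: edge_simps triangle_simps)+
    qed
  next
    case False
    then have diag: "a < c" "b < d"
      using assms by (auto simp: edge_simps less_le)
    consider "b \<noteq> c" "d < m" | "b = c" "d < m" | "d = m"
      using assms by (force simp: edge_simps)
    then show ?thesis
    proof cases
      case 1
      then have "pairing m [(a, b), (c, d)] [(a, b), (c, b), (c, d)]"
        using diag R assms [[linarith_neq_limit = 4]] by (intro pair_e) (auto simp: edge_simps)
      then show ?thesis
        using diag 1 assms by (intro exI conjI) (assumption, auto simp: edge_simps triangle_simps)
    next
      case 2
      then have "pairing m [(a, b), (c, d)] [(a, b), (a, d), (c, d)]"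
        using diag R assms [[linarith_neq_limit = 4]] by (intro pair_f) (auto simp: edge_simps)
      then show ?thesis
        using diag 2 assms by (intro exI conjI) (assumption, auto simp: edge_simps triangle_simps)
    next
      case 3
      then have "pairing m [(a, b), (c, d)] [(a, b), (a, d), (c, d)]"
        using diag R assms [[linarith_neq_limit = 4]] by (intro pair_f) (auto simp: edge_simps)
      then show ?thesis
        using diag 3 assms by (intro exI conjI) (assumption, auto simp: edge_simps triangle_simps)
    qed
  qed
  then show ?L
    using face unfolding W_def by (auto simp: numeral_2_eq_2)
qed

text \<open>These edges form a spanning tree, along which the vertices are collapsed to \<open>(m, m - 1)\<close>.\<close>
lemma edge_target_iff:
  assumes "[(a, b), (c, d)] \<in> faces m 1" "3 \<le> m"
  shows "(\<exists>\<rho>. (\<rho>, [(a, b), (c, d)]) \<in> W m) \<longleftrightarrow>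
    (c, d) = (m, m - 1) \<or> (c, d) = (m - 1, m) \<and> (b = m \<or> (a, b) = (m - 1, m - 2))"
    (is "?L \<longleftrightarrow> ?R")
proof
  assume ?L
  then obtain \<rho> where \<rho>: "(\<rho>, [(a, b), (c, d)]) \<in> W m"
    by blast
  show ?R
    using W_pairing[OF \<rho>] by cases auto
next
  assume R: ?R
  have "\<exists>\<rho>. pairing m \<rho> [(a, b), (c, d)] \<and> \<rho> \<in> faces m 0"
    using R
  proof (elim disjE conjE)
    assume "(c, d) = (m, m - 1)"
    then show ?thesis
      using assms pair_g[of b m a] by (force simp: edge_simps point_iff)
  next
    assume "(c, d) = (m - 1, m)" "b = m"
    then show ?thesis
      using assms pair_h[of a m] by (force simp: edge_simps point_iff)
  next
    assume "(c, d) = (m - 1, m)" "(a, b) = (m - 1, m - 2)"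
    then show ?thesis
      using assms pair_i[of m] by (force simp: edge_simps point_iff)
  qed
  then show ?L
    using assms(1) unfolding W_def by auto
qed

lemma critical_edge_cases:
  assumes "x \<in> critical m 1" "3 \<le> m"
  obtains (corner) a b where "x = [(a, b), (m - 1, m)]" "b < m" "(a, b) \<noteq> (m - 1, m - 2)"
    | (right) b d where "x = [(m, b), (m, d)]" "b < d" "d < m - 1"
    | (top) a c where "x = [(a, m), (c, m)]" "a < c" "c < m - 1"
proof -
  have "x \<in> faces m 1"
    using assms by (simp add: critical_def)
  then obtain a b c d where x: "x = [(a, b), (c, d)]" and face: "[(a, b), (c, d)] \<in> faces m 1"
    by (rule edge_cases)
  have bounds: "a \<le> c" "c \<le> m" "b \<le> d" "d \<le> m" "c \<noteq> d" "a < c \<or> b < d"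
    using face by (auto simp: edge_simps)
  have "\<not> (\<exists>\<beta>. (x, \<beta>) \<in> W m)" "\<not> (\<exists>\<rho>. (\<rho>, x) \<in> W m)"
    using assms by (auto simp: critical_def)
  then have "\<not> (a < m \<and> b < m \<and> (c, d) \<noteq> (m, m - 1) \<and> (c, d) \<noteq> (m - 1, m))"
      "\<not> ((c, d) = (m, m - 1) \<or> (c, d) = (m - 1, m) \<and> (b = m \<or> (a, b) = (m - 1, m - 2)))"
    unfolding x edge_source_iff[OF face] edge_target_iff[OF face assms(2)] by blast+
  then have unpaired: "a = m \<or> b = m \<or> c = m - 1 \<and> d = m" "\<not> (c = m \<and> d = m - 1)"
      "c = m - 1 \<and> d = m \<longrightarrow> b \<noteq> m \<and> (a, b) \<noteq> (m - 1, m - 2)"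
    using order_trans[OF bounds(1,2)] order_trans[OF bounds(3,4)] by (auto simp: less_le)
  consider "c = m - 1" "d = m" | "a = m" "\<not> (c = m - 1 \<and> d = m)" | "b = m" "\<not> (c = m - 1 \<and> d = m)"
    using unpaired by blast
  then consider "c = m - 1" "d = m" "b < m" "(a, b) \<noteq> (m - 1, m - 2)"
    | "a = m" "c = m" "b < d" "d < m - 1" | "b = m" "d = m" "a < c" "c < m - 1"
  proof cases
    case 1
    then show thesis
      using that(1) unpaired(3) bounds by (simp add: le_less)
  next
    case 2
    then have "c = m" "d \<noteq> m - 1" "d \<noteq> m"
      using bounds unpaired(2) by auto
    then have "d < m - 1" "b < d"
      using bounds 2(1) [[linarith_neq_limit = 4]] by linarith+
    then show thesis
      using that(2) 2(1) \<open>c = m\<close> by blast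
  next
    case 3
    then have "d = m" "c \<noteq> m - 1" "c \<noteq> m"
      using bounds by auto
    then have "c < m - 1" "a < c"
      using bounds 3(1) [[linarith_neq_limit = 4]] by linarith+
    then show thesis
      using that(3) 3(1) \<open>d = m\<close> by blast
  qed
  then show thesis
    using that x by cases blast+
qed

text \<open>A triangle through \<open>(a, d)\<close> is the partner of its diagonal if the other corner \<open>(c, b)\<close> is not a
  vertex, and otherwise it is paired with an edge exactly if it reaches the largest entry \<open>m\<close>.\<close>
lemma critical_triangle_iff:
  assumes "3 \<le> m"
  shows "[(a, b), (a, d), (c, d)] \<in> critical m 2 \<longleftrightarrow>
    [(a, b), (a, d), (c, d)] \<in> faces m 2 \<and> b \<noteq> c \<and> c < m \<and> d < m"
proof (cases "[(a, b), (a, d), (c, d)] \<in> faces m 2")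
  case True
  let ?\<rho> = "[(a, b), (a, d), (c, d)]"
  have no_source: "(?\<rho>, \<beta>) \<notin> W m" for \<beta>
    using W_pairing[of ?\<rho> \<beta> m] by (auto elim: pairing.cases)
  have "(\<exists>\<sigma>. (\<sigma>, ?\<rho>) \<in> W m) \<longleftrightarrow> b = c \<or> c = m \<or> d = m"
  proof
    assume "\<exists>\<sigma>. (\<sigma>, ?\<rho>) \<in> W m"
    then obtain \<sigma> where \<sigma>: "(\<sigma>, ?\<rho>) \<in> W m"
      by blast
    show "b = c \<or> c = m \<or> d = m"
      using W_pairing[OF \<sigma>] True by cases (auto simp: triangle_simps)
  next
    assume R: "b = c \<or> c = m \<or> d = m"
    have "\<exists>\<sigma>. pairing m \<sigma> ?\<rho> \<and> \<sigma> \<in> faces m 1"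
    proof -
      have "c \<le> m" "d \<le> m"
        using True by (simp_all add: triangle_simps)
      then have "c = m \<or> d = m \<and> c = m - 1 \<or> d = m \<and> c + 1 < m \<or> b = c \<and> c < m \<and> d < m"
        using R by presburger
      then consider "c = m" | "d = m" "c = m - 1" | "d = m" "c + 1 < m" | "b = c" "c < m" "d < m"
        by blast
      then show ?thesis
      proof cases
        case 1
        then show ?thesis
          using pair_a[of a m d b] True by (force simp: edge_simps triangle_simps)
      next
        case 2
        then show ?thesis
          using pair_b[of a m b] True by (force simp: edge_simps triangle_simps)
      next
        case 3
        then show ?thesis
          using pair_f[of a c b d m] True by (force simp: edge_simps triangle_simps)
      next
        case 4
        then show ?thesis
          using pair_f[of a c b d m] True by (force simp: edge_simps triangle_simps)
      qed
    qed
    then show "\<exists>\<sigma>. (\<sigma>, ?\<rho>) \<in> W m"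
      using True unfolding W_def by (auto simp: numeral_2_eq_2)
  qed
  then show ?thesis
    using True no_source by (auto simp: critical_def triangle_simps)
qed (simp add: critical_def)

text \<open>A step of a path replaces a diagonal by an edge that changes one row only, or gives the last vertex
  an entry \<open>m\<close>, or leads to an extremal vertex. So the rank counts the rows that change,
  with a bonus of 2 as long as the last vertex has no entry \<open>m\<close>: an edge that changes one row may
  become a diagonal when its last vertex acquires this entry. Edges that end at an extremal
  vertex are not paired upwards and get rank 0.\<close>
definition edge_rank :: "nat \<Rightarrow> face \<Rightarrow> nat" where
  "edge_rank m \<sigma> = (if \<sigma> ! 1 = (m, m - 1) \<or> \<sigma> ! 1 = (m - 1, m) then 0
     else of_bool (fst (\<sigma> ! 0) \<noteq> fst (\<sigma> ! 1)) + of_bool (snd (\<sigma> ! 0) \<noteq> snd (\<sigma> ! 1))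
       + (if fst (\<sigma> ! 1) < m \<and> snd (\<sigma> ! 1) < m then 2 else 0))"

lemma edge_rank_eq:
  "edge_rank m [(a, b), (c, d)] = (if (c, d) = (m, m - 1) \<or> (c, d) = (m - 1, m) then 0
     else of_bool (a \<noteq> c) + of_bool (b \<noteq> d) + (if c < m \<and> d < m then 2 else 0))"
  by (simp add: edge_rank_def)

lemma edge_rank_descending: "descending m 1 (edge_rank m)"
  unfolding descending_def
proof (intro ballI allI impI)
  fix \<sigma> \<beta> \<alpha>
  assume \<sigma>: "\<sigma> \<in> faces m 1" and \<beta>: "(\<sigma>, \<beta>) \<in> W m" and \<alpha>: "(\<alpha>, \<beta>) \<in> facets m - W m"
  have \<beta>_face: "\<beta> \<in> faces m 2"
    using \<sigma> W_degree(2)[OF \<beta>] by (simp add: length_face numeral_2_eq_2)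
  have "\<alpha> \<noteq> \<sigma>"
    using \<alpha> \<beta> by auto
  then have other: "\<alpha> = [v, w] \<and> \<sigma> \<noteq> [v, w] \<or> \<alpha> = [u, w] \<and> \<sigma> \<noteq> [u, w] \<or> \<alpha> = [u, v] \<and> \<sigma> \<noteq> [u, v]"
    if "\<beta> = [u, v, w]" for u v w
    using \<alpha> that by (auto simp: facets_def omit_def less_Suc_eq)
  show "edge_rank m \<alpha> < edge_rank m \<sigma>"
    using W_pairing[OF \<beta>]
  proof cases
    case (pair_a a d b)
    then show ?thesis
      using other[OF pair_a(2)] \<beta>_face by (auto simp: edge_rank_eq triangle_simps)
  next
    case (pair_b a b)
    then show ?thesis
      using other[OF pair_b(2)] \<beta>_face by (auto simp: edge_rank_eq triangle_simps)
  next
    case (pair_c b c a)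
    then show ?thesis
      using other[OF pair_c(2)] \<beta>_face by (auto simp: edge_rank_eq triangle_simps)
  next
    case (pair_d b a)
    then show ?thesis
      using other[OF pair_d(2)] \<beta>_face by (auto simp: edge_rank_eq triangle_simps)
  next
    case (pair_e a c b d)
    then show ?thesis
      using other[OF pair_e(2)] \<beta>_face by (auto simp: edge_rank_eq triangle_simps)
  next
    case (pair_f a c b d)
    then show ?thesis
      using other[OF pair_f(2)] \<beta>_face by (auto simp: edge_rank_eq triangle_simps)
  qed (use \<sigma> in \<open>auto dest: length_face\<close>)
qed

section \<open>Cocycles representing the critical edges\<close>

text \<open>For edges, the vanishing of the coboundary is additivity: the value of the long edge of a
  paired triangle is the sum of the values of the short ones.\<close>
lemma upper_Phi_edge_eqI:
  fixes g :: "'r::comm_ring_1 cochain"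
  assumes x: "x \<in> critical m 1"
    and unpaired: "\<And>a b c d. [(a, b), (c, d)] \<in> faces m 1 \<Longrightarrow>
      a = m \<or> b = m \<or> (c, d) = (m, m - 1) \<or> (c, d) = (m - 1, m) \<Longrightarrow>
      g [(a, b), (c, d)] = dual x [(a, b), (c, d)]"
    and cocycle: "\<And>\<sigma> u v w. \<sigma> \<in> faces m 1 \<Longrightarrow> [u, v, w] \<in> faces m 2 \<Longrightarrow> pairing m \<sigma> [u, v, w] \<Longrightarrow>
      g [u, w] = g [u, v] + g [v, w]"
  shows "upper_Phi m 1 (dual x) = (\<lambda>\<sigma>. if \<sigma> \<in> faces m 1 then g \<sigma> else 0)"
proof (rule upper_Phi_eqI[OF edge_rank_descending x])
  fix \<sigma>
  assume "\<sigma> \<in> faces m 1" and no_partner: "\<forall>\<beta>. (\<sigma>, \<beta>) \<notin> W m"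
  then obtain a b c d where \<sigma>: "\<sigma> = [(a, b), (c, d)]" and face: "[(a, b), (c, d)] \<in> faces m 1"
    using edge_cases by metis
  have "\<not> (a < m \<and> b < m \<and> (c, d) \<noteq> (m, m - 1) \<and> (c, d) \<noteq> (m - 1, m))"
    using no_partner unfolding \<sigma> edge_source_iff[OF face, symmetric] by blast
  moreover have "a \<le> m" "b \<le> m"
    using face by (auto simp: edge_simps)
  ultimately show "g \<sigma> = dual x \<sigma>"
    unfolding \<sigma> by (intro unpaired face) (auto simp: less_le)
next
  fix \<sigma> \<beta>
  assume \<sigma>: "\<sigma> \<in> faces m 1" and \<beta>: "(\<sigma>, \<beta>) \<in> W m"
  then have \<beta>_face: "\<beta> \<in> faces m 2"
    using W_degree(2)[OF \<beta>] by (simp add: length_face numeral_2_eq_2)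
  then obtain u v w where "\<beta> = [u, v, w]"
    using triangle_cases by metis
  then show "coboundary g \<beta> = 0"
    using cocycle[OF \<sigma>] \<beta>_face W_pairing[OF \<beta>] by (simp add: coboundary_triangle)
qed

text \<open>This represents the critical edge from \<open>v\<close> to \<open>(m - 1, m)\<close>. A diagonal edge is first replaced by
  the path around the corner prescribed by the pairing: through \<open>(c, b)\<close> if this is a vertex, and
  through \<open>(a, d)\<close> otherwise. In both cases the horizontal piece of the path has the lower entry
  \<open>e\<close>. Moving this piece up to the lower entry \<open>m\<close> leaves vertical edges over its two
  ends, with opposite signs, and the vertical edge over \<open>v\<close> is the one that leads to the given
  critical edge. For \<open>d = m\<close> the horizontal piece has the lower entry \<open>m\<close> already,
  so only the vertical edge over \<open>(a, b)\<close> counts. No path from an edge with \<open>c = m\<close> leads to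
  the given critical edge.\<close>
definition corner_cochain :: "nat \<Rightarrow> nat \<times> nat \<Rightarrow> 'r::comm_ring_1 cochain" where
  "corner_cochain m v \<sigma> = (let (a, b) = \<sigma> ! 0; (c, d) = \<sigma> ! 1; e = (if b = c then d else b) in
     if c = m then 0 else if d = m then of_bool ((a, b) = v)
     else of_bool ((a, e) = v) - of_bool ((c, e) = v))"

lemma corner_cochain_eq:
  "corner_cochain m v [(a, b), (c, d)] = (let e = (if b = c then d else b) in
     if c = m then 0 else if d = m then of_bool ((a, b) = v)
     else of_bool ((a, e) = v) - of_bool ((c, e) = v))"
  by (simp add: corner_cochain_def Let_def)

lemma upper_Phi_corner:
  assumes "3 \<le> m" and x: "[(p, q), (m - 1, m)] \<in> critical m 1" and "q < m" "(p, q) \<noteq> (m - 1, m - 2)"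
  shows "upper_Phi m 1 (dual [(p, q), (m - 1, m)])
    = (\<lambda>\<sigma>. if \<sigma> \<in> faces m 1 then corner_cochain m (p, q) \<sigma> else (0 :: 'r::comm_ring_1))"
proof (rule upper_Phi_edge_eqI[OF x])
  fix a b c d
  assume "[(a, b), (c, d)] \<in> faces m 1"
    and unpaired: "a = m \<or> b = m \<or> (c, d) = (m, m - 1) \<or> (c, d) = (m - 1, m)"
  then have "a \<le> c" "c \<le> m" "b \<le> d" "d \<le> m"
    by (simp_all add: edge_simps)
  then consider "c = m" | "c \<noteq> m" "d = m" "b = m" | "c = m - 1" "d = m"
    using unpaired le_antisym by blast
  then show "corner_cochain m (p, q) [(a, b), (c, d)]
      = (dual [(p, q), (m - 1, m)] [(a, b), (c, d)] :: 'r)"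
    using assms(1,3) by cases (auto simp: corner_cochain_eq dual_def)
next
  fix \<sigma> u v w
  assume "\<sigma> \<in> faces m 1" "[u, v, w] \<in> faces m 2" "pairing m \<sigma> [u, v, w]"
  then show "corner_cochain m (p, q) [u, w]
      = corner_cochain m (p, q) [u, v] + (corner_cochain m (p, q) [v, w] :: 'r)"
    using assms(1,3) by - (erule pairing.cases; auto simp: corner_cochain_eq Let_def triangle_simps)
qed

text \<open>Moving an edge towards the upper entry \<open>m\<close> keeps its bottom row, and moving it towards the lower
  entry \<open>m\<close> keeps its top row. The critical edges that are constant in one row are therefore
  represented by the indicator of their other row. If this row has two different
  values, its indicator is additive on all triangles.\<close>
definition bottom_row_cochain :: "nat \<Rightarrow> nat \<Rightarrow> 'r::comm_ring_1 cochain" where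
  "bottom_row_cochain b d \<sigma> = of_bool (map snd \<sigma> = [b, d])"

definition top_row_cochain :: "nat \<Rightarrow> nat \<Rightarrow> 'r::comm_ring_1 cochain" where
  "top_row_cochain a c \<sigma> = of_bool (map fst \<sigma> = [a, c])"

lemma upper_Phi_right:
  assumes "3 \<le> m" and x: "[(m, b), (m, d)] \<in> critical m 1" and "b < d" "d < m - 1"
  shows "upper_Phi m 1 (dual [(m, b), (m, d)])
    = (\<lambda>\<sigma>. if \<sigma> \<in> faces m 1 then bottom_row_cochain b d \<sigma> else (0 :: 'r::comm_ring_1))"
proof (rule upper_Phi_edge_eqI[OF x])
  fix a' b' c' d'
  assume "[(a', b'), (c', d')] \<in> faces m 1"
    and "a' = m \<or> b' = m \<or> (c', d') = (m, m - 1) \<or> (c', d') = (m - 1, m)"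
  then show "bottom_row_cochain b d [(a', b'), (c', d')]
      = (dual [(m, b), (m, d)] [(a', b'), (c', d')] :: 'r)"
    using assms(1,3,4) by (auto simp: bottom_row_cochain_def dual_def edge_simps)
next
  fix \<sigma> u v w
  assume "[u, v, w] \<in> faces m 2"
  then show "bottom_row_cochain b d [u, w]
      = bottom_row_cochain b d [u, v] + (bottom_row_cochain b d [v, w] :: 'r)"
    using assms(3) by (cases u; cases v; cases w) (auto simp: bottom_row_cochain_def triangle_simps)
qed

lemma upper_Phi_top:
  assumes "3 \<le> m" and x: "[(a, m), (c, m)] \<in> critical m 1" and "a < c" "c < m - 1"
  shows "upper_Phi m 1 (dual [(a, m), (c, m)])
    = (\<lambda>\<sigma>. if \<sigma> \<in> faces m 1 then top_row_cochain a c \<sigma> else (0 :: 'r::comm_ring_1))"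
proof (rule upper_Phi_edge_eqI[OF x])
  fix a' b' c' d'
  assume "[(a', b'), (c', d')] \<in> faces m 1"
    and "a' = m \<or> b' = m \<or> (c', d') = (m, m - 1) \<or> (c', d') = (m - 1, m)"
  then show "top_row_cochain a c [(a', b'), (c', d')]
      = (dual [(a, m), (c, m)] [(a', b'), (c', d')] :: 'r)"
    using assms(1,3,4) by (auto simp: top_row_cochain_def dual_def edge_simps)
next
  fix \<sigma> u v w
  assume "[u, v, w] \<in> faces m 2"
  then show "top_row_cochain a c [u, w]
      = top_row_cochain a c [u, v] + (top_row_cochain a c [v, w] :: 'r)"
    using assms(3) by (cases u; cases v; cases w) (auto simp: top_row_cochain_def triangle_simps)
qed

text \<open>What the three kinds of cocycles have in common. The listed edges on which all of them vanish
  are exactly what excludes the unwanted triangles from the products.\<close>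
lemma upper_Phi_critical_edge:
  assumes "x \<in> critical m 1" "3 \<le> m"
  obtains g :: "'r::comm_ring_1 cochain"
  where "upper_Phi m 1 (dual x) = (\<lambda>\<sigma>. if \<sigma> \<in> faces m 1 then g \<sigma> else 0)"
    and "\<And>\<sigma>. g \<sigma> = 0 \<or> g \<sigma> = 1 \<or> g \<sigma> = - 1"
    and "\<And>a b. g [(a, b), (m, b)] = 0" and "\<And>a b. g [(a, b), (a, m - 1)] = 0"
    and "\<And>a. g [(a, m), (m - 1, m)] = 0" and "g [(m - 1, m - 2), (m - 1, m)] = 0"
  using assms
proof (cases rule: critical_edge_cases)
  case (corner p q)
  show ?thesis
  proof (rule that)
    show "upper_Phi m 1 (dual x) = (\<lambda>\<sigma>. if \<sigma> \<in> faces m 1 then corner_cochain m (p, q) \<sigma> else (0 :: 'r))"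
      unfolding corner(1) by (rule upper_Phi_corner) (use corner assms in simp_all)
    show "corner_cochain m (p, q) \<sigma> = 0 \<or> corner_cochain m (p, q) \<sigma> = 1
        \<or> corner_cochain m (p, q) \<sigma> = (- 1 :: 'r)" for \<sigma>
      by (auto simp: corner_cochain_def Let_def split: prod.splits)
  qed (use corner(2,3) assms(2) in \<open>auto simp: corner_cochain_eq Let_def\<close>)
next
  case (right b d)
  show ?thesis
  proof (rule that)
    show "upper_Phi m 1 (dual x) = (\<lambda>\<sigma>. if \<sigma> \<in> faces m 1 then bottom_row_cochain b d \<sigma> else (0 :: 'r))"
      unfolding right(1) by (rule upper_Phi_right) (use right assms in simp_all)
  qed (use right(2,3) in \<open>auto simp: bottom_row_cochain_def\<close>)
next
  case (top a c)
  show ?thesis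
  proof (rule that)
    show "upper_Phi m 1 (dual x) = (\<lambda>\<sigma>. if \<sigma> \<in> faces m 1 then top_row_cochain a c \<sigma> else (0 :: 'r))"
      unfolding top(1) by (rule upper_Phi_top) (use top assms in simp_all)
  qed (use top(2,3) in \<open>auto simp: top_row_cochain_def\<close>)
qed

section \<open>Products of critical edges\<close>

lemma cup_triangle:
  fixes f g :: "'r::comm_ring_1 cochain"
  assumes "[u, v, w] \<in> faces m 2"
  shows "cup m f g [u, v, w] = f [u, v] * g [v, w]"
proof -
  have face: "[u, v, w] \<in> faces m (1 + 1)"
    using assms by (simp add: numeral_2_eq_2)
  have edges: "[u, v] \<in> faces m 1" "[v, w] \<in> faces m 1"
    using omit_face[OF face, of 2] omit_face[OF face, of 0] by (simp_all add: omit_def)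
  have "cup_dual m \<sigma> \<tau> [u, v, w] = (if \<sigma> = [u, v] then (if \<tau> = [v, w] then 1 else 0) else (0 :: 'r))"
    if "\<sigma> \<in> faces m 1" "\<tau> \<in> faces m 1" for \<sigma> \<tau>
    using length_face[OF that(1)] length_face[OF that(2)] assms
    by (auto simp: length_Suc_conv cup_dual_def dual_def)
  then have "cup m f g [u, v, w] = (\<Sum>\<sigma>\<in>faces m 1. \<Sum>\<tau>\<in>faces m 1.
      if \<sigma> = [u, v] then (if \<tau> = [v, w] then f \<sigma> * g \<tau> else 0) else 0)"
    unfolding cup_def by (intro sum.cong refl) auto
  also have "\<dots> = (\<Sum>\<sigma>\<in>faces m 1. if \<sigma> = [u, v] then f \<sigma> * g [v, w] else 0)"
    using edges finite_faces by (intro sum.cong refl) simp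
  also have "\<dots> = f [u, v] * g [v, w]"
    using edges finite_faces by simp
  finally show ?thesis .
qed

lemma cup_not_triangle:
  assumes "\<rho> \<notin> faces m 2"
  shows "cup m f g \<rho> = 0"
  unfolding cup_def using assms by (intro sum.neutral ballI) (auto simp: cup_dual_def dual_def)

text \<open>The value of a product at a triangle is the product of the values at its first and last edge. One
  of these edges changes only the top row, from \<open>a\<close> to \<open>c\<close>, and the other one only the bottom row,
  from \<open>b\<close> to \<open>d\<close>. The zeros of the cocycles therefore rule out \<open>c = m\<close> and \<open>d = m - 1\<close>, and
  for \<open>d = m\<close> also the last edges that belong to the spanning tree.\<close>
lemma product_support:
  fixes x y :: face
  assumes x: "x \<in> critical m 1" and y: "y \<in> critical m 1" and "3 \<le> m"
  defines "z \<equiv> cup m (upper_Phi m 1 (dual x)) (upper_Phi m 1 (dual y)) :: 'r::comm_ring_1 cochain"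
  shows "z \<rho> = 0 \<or> z \<rho> = 1 \<or> z \<rho> = - 1"
    and "z \<rho> \<noteq> 0 \<Longrightarrow> \<rho> \<in> faces m 2 \<and>
      ((\<exists>a b c d. form_i m a b c d \<and> \<rho> = [(a, b), (a, d), (c, d)]) \<or>
       (\<exists>a b c d. form_ii m a b c d \<and> \<rho> = [(a, b), (c, b), (c, d)]) \<or>
       (\<exists>a b c. form_iii m a b c \<and> \<rho> = [(a, b), (a, m), (c, m)]) \<or>
       (\<exists>a b c. form_iv m a b c \<and> \<rho> = [(a, b), (c, b), (c, m)]))" (is "_ \<Longrightarrow> ?forms")
proof -
  obtain g :: "'r cochain" where g: "upper_Phi m 1 (dual x) = (\<lambda>\<sigma>. if \<sigma> \<in> faces m 1 then g \<sigma> else 0)"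
    and g_values: "\<And>\<sigma>. g \<sigma> = 0 \<or> g \<sigma> = 1 \<or> g \<sigma> = - 1"
    and g_zero: "\<And>a b. g [(a, b), (m, b)] = 0" "\<And>a b. g [(a, b), (a, m - 1)] = 0"
      "\<And>a. g [(a, m), (m - 1, m)] = 0" "g [(m - 1, m - 2), (m - 1, m)] = 0"
    by (rule upper_Phi_critical_edge[OF x \<open>3 \<le> m\<close>]) (rule that)
  obtain h :: "'r cochain" where h: "upper_Phi m 1 (dual y) = (\<lambda>\<sigma>. if \<sigma> \<in> faces m 1 then h \<sigma> else 0)"
    and h_values: "\<And>\<sigma>. h \<sigma> = 0 \<or> h \<sigma> = 1 \<or> h \<sigma> = - 1"
    and h_zero: "\<And>a b. h [(a, b), (m, b)] = 0" "\<And>a b. h [(a, b), (a, m - 1)] = 0"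
      "\<And>a. h [(a, m), (m - 1, m)] = 0" "h [(m - 1, m - 2), (m - 1, m)] = 0"
    by (rule upper_Phi_critical_edge[OF y \<open>3 \<le> m\<close>]) (rule that)
  have z: "z [u, v, w] = (if [u, v] \<in> faces m 1 then g [u, v] else 0) * (if [v, w] \<in> faces m 1 then h [v, w] else 0)"
    if "[u, v, w] \<in> faces m 2" for u v w
    unfolding z_def g h cup_triangle[OF that] ..
  have triangle: "\<exists>u v w. \<rho> = [u, v, w]" if "\<rho> \<in> faces m 2"
    using triangle_cases[OF that] by metis
  show "z \<rho> = 0 \<or> z \<rho> = 1 \<or> z \<rho> = - 1"
  proof (cases "\<rho> \<in> faces m 2")
    case True
    then obtain u v w where "\<rho> = [u, v, w]"
      using triangle by blast
    then show ?thesis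
      using z[of u v w] True g_values[of "[u, v]"] h_values[of "[v, w]"] by auto
  qed (simp add: z_def cup_not_triangle)
  assume nonzero: "z \<rho> \<noteq> 0"
  then have \<rho>: "\<rho> \<in> faces m 2"
    unfolding z_def using cup_not_triangle by metis
  then show ?forms
  proof (cases rule: triangle_cases)
    case (upper a b c d)
    then have "g [(a, b), (a, d)] \<noteq> 0" "h [(a, d), (c, d)] \<noteq> 0"
      using z[OF upper(2)] nonzero by (auto split: if_splits)
    then have ne: "d \<noteq> m - 1" "c \<noteq> m" "\<not> (d = m \<and> c = m - 1)"
      using g_zero h_zero by auto
    have bounds: "a < c" "c \<le> m" "b < d" "d \<le> m" "a \<noteq> b" "a \<noteq> d" "c \<noteq> d"
      using upper(2) by (auto simp: triangle_simps)
    show ?thesis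
    proof (cases "d = m")
      case True
      then have "c < m - 1" "b \<le> m - 1"
        using ne(2,3) bounds(2,3) [[linarith_neq_limit = 4]] by linarith+
      then have "form_iii m a b c"
        using upper(2) bounds True by (simp add: form_iii_def)
      then show ?thesis
        using \<rho> upper(1) True by blast
    next
      case False
      then have "form_i m a b c d"
        using upper(2) bounds ne by (simp add: form_i_def le_neq_implies_less)
      then show ?thesis
        using \<rho> upper(1) by blast
    qed
  next
    case (lower a b c d)
    then have "g [(a, b), (c, b)] \<noteq> 0" "h [(c, b), (c, d)] \<noteq> 0"
      using z[OF lower(2)] nonzero by (auto split: if_splits)
    then have ne: "d \<noteq> m - 1" "c \<noteq> m" "\<not> (d = m \<and> c = m - 1 \<and> b = m - 2)"
      using g_zero h_zero by auto
    have bounds: "a < c" "c \<le> m" "b < d" "d \<le> m" "a \<noteq> b" "b \<noteq> c" "c \<noteq> d"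
      using lower(2) by (auto simp: triangle_simps)
    show ?thesis
    proof (cases "d = m")
      case True
      have "c \<le> m - 1" "b \<le> m - 1"
        using True ne(2) bounds(2,3) by linarith+
      moreover have "b + 1 < m - 1" if "c = m - 1"
        using True that ne(3) bounds(3,6) [[linarith_neq_limit = 4]] by linarith
      ultimately have "c < m - 1 \<or> c = m - 1 \<and> m - 1 > b + 1" "c \<le> m - 1" "b \<le> m - 1"
        by (auto simp: le_less)
      then have "form_iv m a b c"
        using lower(2) bounds True by (simp add: form_iv_def)
      then show ?thesis
        using \<rho> lower(1) True by blast
    next
      case False
      then have "d < m - 1" "c \<le> m - 1"
        using ne(1,2) bounds(2,4) [[linarith_neq_limit = 4]] by linarith+
      then have "form_ii m a b c d"
        using lower(2) bounds by (simp add: form_ii_def)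
      then show ?thesis
        using \<rho> lower(1) by blast
    qed
  qed
qed

section \<open>Reduction of triangles to critical ones\<close>

text \<open>The reduction principle with the explicit descriptions of paired edges and of critical
  triangles.\<close>
lemma lower_Phi_triangle_eqI:
  fixes h R :: "'r::comm_ring_1 cochain"
  assumes \<tau>: "\<tau> \<in> faces m 2" and "3 \<le> m"
    and unpaired: "\<And>a b c d. [(a, b), (c, d)] \<in> faces m 1 \<Longrightarrow>
      a = m \<or> b = m \<or> (c, d) = (m, m - 1) \<or> (c, d) = (m - 1, m) \<Longrightarrow> h [(a, b), (c, d)] = 0"
    and R: "\<And>\<rho>. \<rho> \<in> faces m 2 \<Longrightarrow> dual \<tau> \<rho> - coboundary h \<rho> = R \<rho>"
    and support: "\<And>\<rho>. R \<rho> \<noteq> 0 \<Longrightarrow>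
      \<exists>a b c d. \<rho> = [(a, b), (a, d), (c, d)] \<and> \<rho> \<in> faces m 2 \<and> b \<noteq> c \<and> c < m \<and> d < m"
  shows "lower_Phi m 2 (dual \<tau>) = R"
proof (rule lower_Phi_eqI[of m 1, unfolded one_add_one, OF edge_rank_descending \<tau>])
  fix \<sigma>
  assume "\<sigma> \<in> faces m 1" and no_partner: "\<forall>\<beta>. (\<sigma>, \<beta>) \<notin> W m"
  then obtain a b c d where \<sigma>: "\<sigma> = [(a, b), (c, d)]" and face: "[(a, b), (c, d)] \<in> faces m 1"
    using edge_cases by metis
  have "\<not> (a < m \<and> b < m \<and> (c, d) \<noteq> (m, m - 1) \<and> (c, d) \<noteq> (m - 1, m))"
    using no_partner unfolding \<sigma> edge_source_iff[OF face, symmetric] by blast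
  moreover have "a \<le> m" "b \<le> m"
    using face by (auto simp: edge_simps)
  ultimately show "h \<sigma> = 0"
    unfolding \<sigma> by (intro unpaired face) (auto simp: less_le)
next
  fix \<rho>
  assume "\<rho> \<notin> critical m 2"
  then show "R \<rho> = 0"
    using support[of \<rho>] critical_triangle_iff[OF \<open>3 \<le> m\<close>] by blast
qed (rule R)

text \<open>A diagonal lies in at most two triangles, through the two corners of its rectangle. This single
  relation settles the cases in which the image is zero or one triangle.\<close>
lemma coboundary_dual_diagonal:
  assumes "\<rho> \<in> faces m 2" "a < c" "b < d"
  shows "coboundary (dual [(a, b), (c, d)]) \<rho>
    = - dual [(a, b), (a, d), (c, d)] \<rho> - (dual [(a, b), (c, b), (c, d)] \<rho> :: 'r::comm_ring_1)"
  using assms(1)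
  by (cases rule: triangle_cases) (use assms(2,3) in \<open>auto simp: coboundary_triangle dual_def triangle_simps\<close>)

lemma coboundary_add: "coboundary (\<lambda>\<sigma>. f \<sigma> + g \<sigma>) \<rho> = coboundary f \<rho> + coboundary g \<rho>"
  by (simp add: coboundary_def distrib_left sum.distrib)

lemma coboundary_minus: "coboundary (\<lambda>\<sigma>. - g \<sigma>) \<rho> = - coboundary g \<rho>"
  by (simp add: coboundary_def sum_negf)

text \<open>If \<open>b = c\<close>, the triangle is the only one that contains its diagonal, hence a coboundary.\<close>
lemma lower_Phi_form_i:
  assumes "form_i m a b c d" "3 \<le> m"
  shows "lower_Phi m 2 (dual [(a, b), (a, d), (c, d)] :: 'r::comm_ring_1 cochain)
    = (if b \<noteq> c then dual [(a, b), (a, d), (c, d)] else (\<lambda>_. 0))"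
proof (cases "b = c")
  case False
  have "lower_Phi m 2 (dual [(a, b), (a, d), (c, d)]) = (dual [(a, b), (a, d), (c, d)] :: 'r cochain)"
    using assms False
    by (intro lower_Phi_triangle_eqI[where h = "\<lambda>_. 0"])
      (auto simp: form_i_def coboundary_def dual_def split: if_splits)
  then show ?thesis
    using False by simp
next
  case True
  have "lower_Phi m 2 (dual [(a, b), (a, d), (c, d)]) = (\<lambda>_. 0 :: 'r)"
  proof (intro lower_Phi_triangle_eqI[where h = "\<lambda>\<sigma>. - dual [(a, b), (c, d)] \<sigma>"])
    fix \<rho>
    assume \<rho>: "\<rho> \<in> faces m 2"
    then have "dual [(a, b), (c, b), (c, d)] \<rho> = (0 :: 'r)"
      using True by (auto simp: dual_def triangle_simps)
    then show "dual [(a, b), (a, d), (c, d)] \<rho> - coboundary (\<lambda>\<sigma>. - dual [(a, b), (c, d)] \<sigma>) \<rho> = (0 :: 'r)"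
      using \<rho> assms by (simp add: coboundary_minus coboundary_dual_diagonal form_i_def)
  qed (use assms in \<open>auto simp: form_i_def dual_def\<close>)
  then show ?thesis
    using True by simp
qed

text \<open>The relation of the diagonal exchanges the two corners of the rectangle, at the cost of a sign;
  for \<open>a = d\<close> there is no second corner.\<close>
lemma lower_Phi_form_ii:
  assumes "form_ii m a b c d" "3 \<le> m"
  shows "lower_Phi m 2 (dual [(a, b), (c, b), (c, d)] :: 'r::comm_ring_1 cochain)
    = (if a \<noteq> d then (\<lambda>\<rho>. - dual [(a, b), (a, d), (c, d)] \<rho>) else (\<lambda>_. 0))"
proof (intro lower_Phi_triangle_eqI[where h = "\<lambda>\<sigma>. - dual [(a, b), (c, d)] \<sigma>"])
  fix \<rho>
  assume \<rho>: "\<rho> \<in> faces m 2"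
  then have "a = d \<Longrightarrow> dual [(a, b), (a, d), (c, d)] \<rho> = (0 :: 'r)"
    by (auto simp: dual_def triangle_simps)
  then show "dual [(a, b), (c, b), (c, d)] \<rho> - coboundary (\<lambda>\<sigma>. - dual [(a, b), (c, d)] \<sigma>) \<rho>
      = ((if a \<noteq> d then (\<lambda>\<rho>. - dual [(a, b), (a, d), (c, d)] \<rho>) else (\<lambda>_. 0)) \<rho> :: 'r)"
    using \<rho> assms by (auto simp: coboundary_minus coboundary_dual_diagonal form_ii_def)
qed (use assms in \<open>auto simp: form_ii_def dual_def triangle_simps split: if_splits\<close>)

text \<open>All edges with top row \<open>a\<close>, \<open>c\<close> and without an entry \<open>m\<close> whose path around the prescribed corner
  has its horizontal piece at height \<open>b\<close>, that is, with lower entry \<open>b\<close>.\<close>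
definition sweep_cochain :: "nat \<Rightarrow> nat \<Rightarrow> nat \<Rightarrow> nat \<Rightarrow> 'r::comm_ring_1 cochain" where
  "sweep_cochain m a b c \<sigma> = of_bool (map fst \<sigma> = [a, c] \<and> snd (\<sigma> ! 1) < m
     \<and> (if snd (\<sigma> ! 0) = c then snd (\<sigma> ! 1) else snd (\<sigma> ! 0)) = b)"

definition sweep_sum :: "nat \<Rightarrow> nat \<Rightarrow> nat \<Rightarrow> nat \<Rightarrow> 'r::comm_ring_1 cochain" where
  "sweep_sum m a b c \<rho> =
     (\<Sum>x | b < x \<and> x < m \<and> a \<noteq> x \<and> x \<noteq> c. dual [(a, b), (a, x), (c, x)] \<rho>)
     - (\<Sum>y | 1 \<le> y \<and> y < b \<and> a \<noteq> y \<and> y \<noteq> c. dual [(a, y), (a, b), (c, b)] \<rho>)"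

lemma sum_dual:
  assumes "finite X" "inj_on F X"
  shows "(\<Sum>x\<in>X. dual (F x) \<rho>) = (of_bool (\<rho> \<in> F ` X) :: 'r::comm_ring_1)"
proof -
  have "(\<Sum>x\<in>X. dual (F x) \<rho>) = (\<Sum>\<sigma>\<in>F ` X. dual \<sigma> \<rho> :: 'r)"
    by (simp add: sum.reindex[OF assms(2)])
  also have "\<dots> = of_bool (\<rho> \<in> F ` X)"
    using assms(1) by (simp add: dual_def)
  finally show ?thesis .
qed

lemma sweep_sum_eq:
  "sweep_sum m a b c \<rho> = (of_bool (\<exists>x. b < x \<and> x < m \<and> a \<noteq> x \<and> x \<noteq> c \<and> \<rho> = [(a, b), (a, x), (c, x)])
     - of_bool (\<exists>y. 1 \<le> y \<and> y < b \<and> a \<noteq> y \<and> y \<noteq> c \<and> \<rho> = [(a, y), (a, b), (c, b)]) :: 'r::comm_ring_1)"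
  unfolding sweep_sum_def
  by (subst (1 2) sum_dual) (auto simp: inj_on_def image_iff intro!: arg_cong2[of _ _ _ _ "(-)"] arg_cong[of _ _ of_bool])

text \<open>On a triangle through \<open>(c, b')\<close>, the diagonal and the horizontal edge have the same height
  \<open>b'\<close> and cancel, unless the diagonal ends at the lower entry \<open>m\<close>. On a triangle through
  \<open>(a, d')\<close> with \<open>d' < m\<close>, the horizontal edge has height \<open>d'\<close> and the diagonal has height
  \<open>b'\<close>, or again \<open>d'\<close> if \<open>b' = c\<close>. Of the latter triangles, exactly those with \<open>b' \<noteq> c\<close>
  and \<open>b' = b\<close> or \<open>d' = b\<close> survive, with opposite signs in the two cases.\<close>
lemma coboundary_sweep:
  assumes "a < c" "c < m" "1 \<le> b" "b < m" "b \<noteq> c" "a \<noteq> b" and \<rho>: "\<rho> \<in> faces m 2"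
  shows "coboundary (sweep_cochain m a b c) \<rho>
    = dual [(a, b), (c, b), (c, m)] \<rho> - (sweep_sum m a b c \<rho> :: 'r::comm_ring_1)"
  using \<rho>
proof (cases rule: triangle_cases)
  case (upper a' b' c' d')
  then show ?thesis
    using assms by (auto simp: coboundary_triangle sweep_cochain_def sweep_sum_eq dual_def triangle_simps)
next
  case (lower a' b' c' d')
  then show ?thesis
    using assms by (auto simp: coboundary_triangle sweep_cochain_def sweep_sum_eq dual_def triangle_simps)
qed

lemma sweep_sum_support:
  assumes "a < c" "c < m" "1 \<le> a" "1 \<le> b" "b < m" "b \<noteq> c" "a \<noteq> b"
    and "sweep_sum m a b c \<rho> \<noteq> (0 :: 'r::comm_ring_1)"
  shows "\<exists>a b c d. \<rho> = [(a, b), (a, d), (c, d)] \<and> \<rho> \<in> faces m 2 \<and> b \<noteq> c \<and> c < m \<and> d < m"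
proof -
  have "(\<exists>x. b < x \<and> x < m \<and> a \<noteq> x \<and> x \<noteq> c \<and> \<rho> = [(a, b), (a, x), (c, x)])
      \<or> (\<exists>y. 1 \<le> y \<and> y < b \<and> a \<noteq> y \<and> y \<noteq> c \<and> \<rho> = [(a, y), (a, b), (c, b)])"
    using assms(8) unfolding sweep_sum_eq by (rule contrapos_np) (simp only: de_Morgan_disj simp_thms of_bool_eq diff_self)
  then show ?thesis
    using assms(1-7) by (fastforce simp: triangle_simps)
qed

lemma lower_Phi_form_iv:
  assumes "form_iv m a b c" "3 \<le> m"
  shows "lower_Phi m 2 (dual [(a, b), (c, b), (c, m)] :: 'r::comm_ring_1 cochain) = sweep_sum m a b c"
proof -
  have *: "a < c" "c < m" "1 \<le> a" "1 \<le> b" "b < m" "b \<noteq> c" "a \<noteq> b"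
    using assms by (auto simp: form_iv_def triangle_simps)
  show ?thesis
  proof (intro lower_Phi_triangle_eqI[where h = "sweep_cochain m a b c"] sweep_sum_support[OF *])
    fix a' b' c' d'
    assume "[(a', b'), (c', d')] \<in> faces m 1"
      and "a' = m \<or> b' = m \<or> (c', d') = (m, m - 1) \<or> (c', d') = (m - 1, m)"
    then show "sweep_cochain m a b c [(a', b'), (c', d')] = (0 :: 'r)"
      using * by (auto simp: sweep_cochain_def edge_simps)
  qed (use assms * in \<open>auto simp: form_iv_def coboundary_sweep\<close>)
qed

text \<open>For \<open>b \<noteq> c\<close> the relation of the diagonal from \<open>(a, b)\<close> to \<open>(c, m)\<close> exchanges this triangle with
  the one through \<open>(c, b)\<close>, whose image is known, up to sign. For \<open>b = c\<close> that corner is missing, and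
  the triangle is a coboundary.\<close>
lemma lower_Phi_form_iii:
  assumes "form_iii m a b c" "3 \<le> m"
  shows "lower_Phi m 2 (dual [(a, b), (a, m), (c, m)] :: 'r::comm_ring_1 cochain)
    = (if b \<noteq> c then (\<lambda>\<rho>. - sweep_sum m a b c \<rho>) else (\<lambda>_. 0))"
proof (cases "b = c")
  case True
  have "lower_Phi m 2 (dual [(a, b), (a, m), (c, m)]) = (\<lambda>_. 0 :: 'r)"
  proof (intro lower_Phi_triangle_eqI[where h = "\<lambda>\<sigma>. - dual [(a, b), (c, m)] \<sigma>"])
    fix \<rho>
    assume \<rho>: "\<rho> \<in> faces m 2"
    then have "dual [(a, b), (c, b), (c, m)] \<rho> = (0 :: 'r)"
      using True by (auto simp: dual_def triangle_simps)
    then show "dual [(a, b), (a, m), (c, m)] \<rho> - coboundary (\<lambda>\<sigma>. - dual [(a, b), (c, m)] \<sigma>) \<rho> = (0 :: 'r)"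
      using \<rho> assms by (auto simp: coboundary_minus coboundary_dual_diagonal form_iii_def)
  qed (use assms in \<open>auto simp: form_iii_def dual_def\<close>)
  then show ?thesis
    using True by simp
next
  case False
  have *: "a < c" "c < m" "1 \<le> a" "1 \<le> b" "b < m" "b \<noteq> c" "a \<noteq> b"
    using assms False by (auto simp: form_iii_def triangle_simps)
  have "lower_Phi m 2 (dual [(a, b), (a, m), (c, m)]) = (\<lambda>\<rho>. - sweep_sum m a b c \<rho> :: 'r)"
  proof (intro lower_Phi_triangle_eqI[where
        h = "\<lambda>\<sigma>. - (dual [(a, b), (c, m)] \<sigma> + sweep_cochain m a b c \<sigma>)"])
    fix a' b' c' d'
    assume "[(a', b'), (c', d')] \<in> faces m 1"
      and "a' = m \<or> b' = m \<or> (c', d') = (m, m - 1) \<or> (c', d') = (m - 1, m)"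
    then show "- (dual [(a, b), (c, m)] [(a', b'), (c', d')]
        + sweep_cochain m a b c [(a', b'), (c', d')]) = (0 :: 'r)"
      using * assms(1) by (auto simp: sweep_cochain_def dual_def edge_simps form_iii_def)
  next
    fix \<rho>
    assume \<rho>: "\<rho> \<in> faces m 2"
    show "dual [(a, b), (a, m), (c, m)] \<rho>
        - coboundary (\<lambda>\<sigma>. - (dual [(a, b), (c, m)] \<sigma> + sweep_cochain m a b c \<sigma>)) \<rho>
        = (- sweep_sum m a b c \<rho> :: 'r)"
      unfolding coboundary_minus coboundary_add coboundary_dual_diagonal[OF \<rho> *(1,5)]
        coboundary_sweep[OF *(1,2,4-7) \<rho>] by simp
  next
    fix \<rho>
    assume "- sweep_sum m a b c \<rho> \<noteq> (0 :: 'r)"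
    then show "\<exists>a b c d. \<rho> = [(a, b), (a, d), (c, d)] \<and> \<rho> \<in> faces m 2 \<and> b \<noteq> c \<and> c < m \<and> d < m"
      using sweep_sum_support[OF *, of \<rho>, where 'r = 'r] by simp
  qed (use assms in \<open>auto simp: form_iii_def\<close>)
  then show ?thesis
    using False by simp
qed

theorem proposition4p13:
  fixes m :: nat
  assumes "m \<ge> 5"
  shows
    "(\<forall>x\<in>critical m 1. \<forall>y\<in>critical m 1.
        \<exists>S (\<epsilon> :: face \<Rightarrow> 'r::comm_ring_1).
          finite S \<and> (\<forall>\<sigma>\<in>S. \<epsilon> \<sigma> = 1 \<or> \<epsilon> \<sigma> = -1) \<and>
          cup m (upper_Phi m 1 (dual x)) (upper_Phi m 1 (dual y))
            = (\<lambda>\<rho>. \<Sum>\<sigma>\<in>S. \<epsilon> \<sigma> * dual \<sigma> \<rho>) \<and>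
          (\<forall>\<sigma>\<in>S.
             (\<exists>a b c d. form_i m a b c d \<and> \<sigma> = [(a, b), (a, d), (c, d)]) \<or>
             (\<exists>a b c d. form_ii m a b c d \<and> \<sigma> = [(a, b), (c, b), (c, d)]) \<or>
             (\<exists>a b c. form_iii m a b c \<and> \<sigma> = [(a, b), (a, m), (c, m)]) \<or>
             (\<exists>a b c. form_iv m a b c \<and> \<sigma> = [(a, b), (c, b), (c, m)])))
     \<and> (\<forall>a b c d. form_i m a b c d \<longrightarrow>
          lower_Phi m 2 (dual [(a, b), (a, d), (c, d)] :: 'r cochain)
            = (if b \<noteq> c then dual [(a, b), (a, d), (c, d)] else (\<lambda>_. 0)))
     \<and> (\<forall>a b c d. form_ii m a b c d \<longrightarrow>
          lower_Phi m 2 (dual [(a, b), (c, b), (c, d)] :: 'r cochain)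
            = (if a \<noteq> d then (\<lambda>\<rho>. - dual [(a, b), (a, d), (c, d)] \<rho>) else (\<lambda>_. 0)))
     \<and> (\<forall>a b c. form_iii m a b c \<longrightarrow>
          lower_Phi m 2 (dual [(a, b), (a, m), (c, m)] :: 'r cochain)
            = (if b \<noteq> c then
                 (\<lambda>\<rho>. (\<Sum>y | 1 \<le> y \<and> y < b \<and> a \<noteq> y \<and> y \<noteq> c. dual [(a, y), (a, b), (c, b)] \<rho>)
                    - (\<Sum>x | b < x \<and> x < m \<and> a \<noteq> x \<and> x \<noteq> c. dual [(a, b), (a, x), (c, x)] \<rho>))
               else (\<lambda>_. 0)))
     \<and> (\<forall>a b c. form_iv m a b c \<longrightarrow>
          lower_Phi m 2 (dual [(a, b), (c, b), (c, m)] :: 'r cochain)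
            = (\<lambda>\<rho>. (\<Sum>x | b < x \<and> x < m \<and> a \<noteq> x \<and> x \<noteq> c. dual [(a, b), (a, x), (c, x)] \<rho>)
                 - (\<Sum>y | 1 \<le> y \<and> y < b \<and> a \<noteq> y \<and> y \<noteq> c. dual [(a, y), (a, b), (c, b)] \<rho>)))"
proof (intro conjI ballI allI impI)
  fix x y
  assume x: "x \<in> critical m 1" and y: "y \<in> critical m 1"
  have m: "3 \<le> m"
    using assms by simp
  let ?z = "cup m (upper_Phi m 1 (dual x)) (upper_Phi m 1 (dual y)) :: 'r cochain"
  let ?S = "{\<rho>. ?z \<rho> \<noteq> 0}"
  note support = product_support[OF x y m, where 'r = 'r]
  have "finite ?S"
    by (rule finite_subset[OF _ finite_faces[of m 2]]) (use support(2) in blast)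
  moreover have "\<forall>\<sigma>\<in>?S. ?z \<sigma> = 1 \<or> ?z \<sigma> = - 1"
    using support(1) by blast
  moreover have "?z = (\<lambda>\<rho>. \<Sum>\<sigma>\<in>?S. ?z \<sigma> * dual \<sigma> \<rho>)"
  proof
    fix \<rho>
    have "(\<Sum>\<sigma>\<in>?S. ?z \<sigma> * dual \<sigma> \<rho>) = (\<Sum>\<sigma>\<in>?S. if \<rho> = \<sigma> then ?z \<sigma> else 0)"
      by (intro sum.cong) (auto simp: dual_def)
    then show "?z \<rho> = (\<Sum>\<sigma>\<in>?S. ?z \<sigma> * dual \<sigma> \<rho>)"
      using \<open>finite ?S\<close> by auto
  qed
  ultimately show "\<exists>S (\<epsilon> :: face \<Rightarrow> 'r). finite S \<and> (\<forall>\<sigma>\<in>S. \<epsilon> \<sigma> = 1 \<or> \<epsilon> \<sigma> = -1) \<and>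
      ?z = (\<lambda>\<rho>. \<Sum>\<sigma>\<in>S. \<epsilon> \<sigma> * dual \<sigma> \<rho>) \<and>
      (\<forall>\<sigma>\<in>S.
         (\<exists>a b c d. form_i m a b c d \<and> \<sigma> = [(a, b), (a, d), (c, d)]) \<or>
         (\<exists>a b c d. form_ii m a b c d \<and> \<sigma> = [(a, b), (c, b), (c, d)]) \<or>
         (\<exists>a b c. form_iii m a b c \<and> \<sigma> = [(a, b), (a, m), (c, m)]) \<or>
         (\<exists>a b c. form_iv m a b c \<and> \<sigma> = [(a, b), (c, b), (c, m)]))"
    using support(2) by (intro exI[of _ ?S] exI[of _ ?z] conjI) auto
next
  fix a b c d
  assume "form_i m a b c d"
  then show "lower_Phi m 2 (dual [(a, b), (a, d), (c, d)] :: 'r cochain)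
      = (if b \<noteq> c then dual [(a, b), (a, d), (c, d)] else (\<lambda>_. 0))"
    using assms by (intro lower_Phi_form_i) simp_all
next
  fix a b c d
  assume "form_ii m a b c d"
  then show "lower_Phi m 2 (dual [(a, b), (c, b), (c, d)] :: 'r cochain)
      = (if a \<noteq> d then (\<lambda>\<rho>. - dual [(a, b), (a, d), (c, d)] \<rho>) else (\<lambda>_. 0))"
    using assms by (intro lower_Phi_form_ii) simp_all
next
  fix a b c
  assume "form_iii m a b c"
  then have "lower_Phi m 2 (dual [(a, b), (a, m), (c, m)] :: 'r cochain)
      = (if b \<noteq> c then (\<lambda>\<rho>. - sweep_sum m a b c \<rho>) else (\<lambda>_. 0))"
    using assms by (intro lower_Phi_form_iii) simp_all
  then show "lower_Phi m 2 (dual [(a, b), (a, m), (c, m)] :: 'r cochain)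
      = (if b \<noteq> c then
           (\<lambda>\<rho>. (\<Sum>y | 1 \<le> y \<and> y < b \<and> a \<noteq> y \<and> y \<noteq> c. dual [(a, y), (a, b), (c, b)] \<rho>)
              - (\<Sum>x | b < x \<and> x < m \<and> a \<noteq> x \<and> x \<noteq> c. dual [(a, b), (a, x), (c, x)] \<rho>))
         else (\<lambda>_. 0))"
    by (simp only: sweep_sum_def minus_diff_eq)
next
  fix a b c
  assume "form_iv m a b c"
  then have "lower_Phi m 2 (dual [(a, b), (c, b), (c, m)] :: 'r cochain) = (\<lambda>\<rho>. sweep_sum m a b c \<rho>)"
    using assms by (intro lower_Phi_form_iv) simp_all
  then show "lower_Phi m 2 (dual [(a, b), (c, b), (c, m)] :: 'r cochain)
      = (\<lambda>\<rho>. (\<Sum>x | b < x \<and> x < m \<and> a \<noteq> x \<and> x \<noteq> c. dual [(a, b), (a, x), (c, x)] \<rho>)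
           - (\<Sum>y | 1 \<le> y \<and> y < b \<and> a \<noteq> y \<and> y \<noteq> c. dual [(a, y), (a, b), (c, b)] \<rho>))"
    by (simp only: sweep_sum_def)
qed

end
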